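(* Let $X$ be a compact metric space, $G_1=\{\mathrm{id}_X,f_1,\dots,f_m\}$ a finite set of continuous self-maps of $X$, and $\Phi=(\phi_1,\dots,\phi_m)\in\mathcal C(X,\mathbb R^m)$ a continuous multi-potential. Then $$P^A(\Phi,G_1)+\log m\le P(\Phi^+,F)=P(\hat\Phi,\hat\sigma)\le P_u(\Phi,G_1)+\log m.$$
   Context: Let $(X,d)$ be a compact metric space, $f_1,\dots,f_m:X\to X$ continuous, $f_{j_1\dots j_n}:=f_{j_1}\circ\dots\circ f_{j_n}$. $\Sigma_m^*$ is the set of finite words $C=(i_1,\dots,i_n)$, $n\ge1$, over $\{1,\dots,m\}$, $n(C)=n$; $\Sigma_m^+$ is the space of one-sided sequences $\omega=(\omega_0,\omega_1,\dots)$ and $\Sigma_m$ the space of two-sided sequences $\eta=(\dots,\eta_{-1},\eta_0,\eta_1,\dots)$ over $\{1,\dots,m\}$, each with its shift $\sigma$. Skew product: $F:\Sigma_m^+\times X\to\Sigma_m^+\times X$, $F(\omega,x)=(\sigma\omega,f_{\omega_0}(x))$, and $\Phi^+(\omega,x)=\phi_{\omega_0}(x)$. Inverse limit of $G_1$: $$\hat X_{G_1}=\{(\eta,\hat x)\in\Sigma_m\times X^{\mathbb Z}:\ \hat x=(\dots,x_{-1},x_0,x_1,\dots),\ x_j=f_{\eta_{j-1}}(x_{j-1})\ \forall j\in\mathbb Z\},$$ with the (compact) product topology, homeomorphism $\hat\sigma(\eta,\hat x)=(\sigma\eta,\sigma\hat x)$, and $\hat\Phi(\eta,\hat x)=\phi_{\eta_0}(x_0)$.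 $P(\Phi^+,F)$ and $P(\hat\Phi,\hat\sigma)$ are the usual topological pressures. For $C=(i_1,\dots,i_n)$, $$B_n(y,C,\varepsilon)=\{z\in X: d(y,z)<\varepsilon,\ d(f_{i_k\dots i_1}(y),f_{i_k\dots i_1}(z))<\varepsilon,\ 1\le k\le n\},$$ $S_n\Phi(y,C)=\phi_{i_1}(y)+\phi_{i_2}(f_{i_1}(y))+\dots+\phi_{i_n}(f_{i_{n-1}\dots i_1}(y))$; for $\omega\in\Sigma_m^+$ set $B_n(y,\omega,\varepsilon)=B_n(y,(\omega_0,\dots,\omega_{n-1}),\varepsilon)$ and $S_n\Phi(y,\omega)=S_n\Phi(y,(\omega_0,\dots,\omega_{n-1}))$. Amalgamated pressure $P^A(\Phi,G_1)$ on $X$: $$M(\lambda,\Phi,N,\varepsilon)=\inf_\Gamma\sum_{(C,y)\in\Gamma}\exp(-\lambda n(C)+S_{n(C)}\Phi(y,C)),$$ the infimum over at most countable $\Gamma\subset\Sigma_m^*\times X$ with $X\subset\bigcup_{(C,y)\in\Gamma}B_{n(C)}(y,C,\varepsilon)$ and $n(C)\ge N$ for all $(C,y)\in\Gamma$; $m(\lambda,\Phi,\varepsilon)=\lim_{N\to\infty}M(\lambda,\Phi,N,\varepsilon)$; $P^A(\Phi,G_1,\varepsilon)=\inf\{\lambda:m(\lambda,\Phi,\varepsilon)=0\}$; $P^A(\Phi,G_1)=\lim_{\varepsilon\to0}P^A(\Phi,G_1,\varepsilon)$. Upper condensed pressure $P_u(\Phi,G_1)$ on $X$: let $B_n(x,G_1,\varepsilon)=\bigcap_{\omega\in\Sigma_m^+}B_n(x,\omega,\varepsilon)$,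 $S_n\Phi(x)=\sup_{\omega\in\Sigma_m^+}S_n\Phi(x,\omega)$, and $$M_{u,N}(\Phi,\lambda,\varepsilon)=\inf\sum_{x\in\mathcal F}\exp(S_n\Phi(x)-\lambda n),$$ the infimum over at most countable families of centers $x\in\mathcal F\subset X$ with integers $n=n(x)\ge N$ (allowed to vary with $x$) such that $X\subset\bigcup_{x\in\mathcal F}B_n(x,G_1,\varepsilon)$; $m_u=\lim_{N\to\infty}M_{u,N}$; $P_u(\Phi,G_1,\varepsilon)=\inf\{\lambda:m_u(\Phi,\lambda,\varepsilon)=0\}$; $P_u(\Phi,G_1)=\lim_{\varepsilon\to0}P_u(\Phi,G_1,\varepsilon)$. Pressures take values in the extended reals. *)

theory Defs
  imports "HOL-Analysis.Analysis"
begin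

text \<open>
  A compact metric space is a compact set \<open>X\<close> in a type of class \<open>metric_space\<close>. The generators
  \<open>f\<^sub>1, \<dots>, f\<^sub>m\<close> and the components \<open>\<phi>\<^sub>1, \<dots>, \<phi>\<^sub>m\<close> of the potential are families indexed by \<open>nat\<close>,
  of which only the indices in \<open>{1..m}\<close> matter.
\<close>

section \<open>Discrete metric on the alphabet\<close>

text \<open>The induced topology is the library's (discrete) topology on \<open>nat\<close>.\<close>

instantiation nat :: metric_space
begin

definition dist_nat :: "nat \<Rightarrow> nat \<Rightarrow> real" where
  "dist_nat i j = (if i = j then 0 else 1)"

definition uniformity_nat :: "(nat \<times> nat) filter" where
  "uniformity_nat = (INF e\<in>{0<..}. principal {(x, y). dist x y < e})"

instance
proof
  show "uniformity = (INF e\<in>{0<..}. principal {(x::nat, y). dist x y < e})"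
    by (rule uniformity_nat_def)
next
  fix U :: "nat set"
  have "\<forall>\<^sub>F (x', y) in INF e\<in>{0<..}. principal {(x, y). dist x y < e}. x' = x \<longrightarrow> y \<in> U"
    if "x \<in> U" for x
    by (rule eventually_INF1[of 1]) (use that in \<open>auto simp: eventually_principal dist_nat_def split: if_splits\<close>)
  then show "open U \<longleftrightarrow> (\<forall>x\<in>U. \<forall>\<^sub>F (x', y) in uniformity. x' = x \<longrightarrow> y \<in> U)"
    by (simp add: uniformity_nat_def open_discrete)
qed (auto simp: dist_nat_def)

end

section \<open>Topological pressure of a continuous self-map of a compact metric space\<close>

definition ln_ennreal :: "ennreal \<Rightarrow> ereal" where
  "ln_ennreal x = (if x = 0 then -\<infinity> else if x = \<infinity> then \<infinity> else ereal (ln (enn2real x)))"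

definition birkhoff_sum :: "('b \<Rightarrow> 'b) \<Rightarrow> ('b \<Rightarrow> real) \<Rightarrow> nat \<Rightarrow> 'b \<Rightarrow> real" where
  "birkhoff_sum T \<psi> n x = (\<Sum>i<n. \<psi> ((T ^^ i) x))"

definition spanning :: "'b::metric_space set \<Rightarrow> ('b \<Rightarrow> 'b) \<Rightarrow> nat \<Rightarrow> real \<Rightarrow> 'b set \<Rightarrow> bool" where
  "spanning K T n \<epsilon> E \<longleftrightarrow>
     E \<subseteq> K \<and> (\<forall>x\<in>K. \<exists>y\<in>E. \<forall>i<n. dist ((T ^^ i) x) ((T ^^ i) y) \<le> \<epsilon>)"

text \<open>
  Since the weights are bounded away from \<open>0\<close> on a compact set for fixed \<open>n\<close>, infinite spanning sets
  have infinite weight, so only the finite ones matter for the infimum.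
\<close>

definition spanning_weight ::
    "'b::metric_space set \<Rightarrow> ('b \<Rightarrow> 'b) \<Rightarrow> ('b \<Rightarrow> real) \<Rightarrow> nat \<Rightarrow> real \<Rightarrow> ennreal" where
  "spanning_weight K T \<psi> n \<epsilon> =
     (INF E\<in>{E. finite E \<and> spanning K T n \<epsilon> E}. \<Sum>x\<in>E. ennreal (exp (birkhoff_sum T \<psi> n x)))"

definition topological_pressure ::
    "'b::metric_space set \<Rightarrow> ('b \<Rightarrow> 'b) \<Rightarrow> ('b \<Rightarrow> real) \<Rightarrow> ereal" where
  "topological_pressure K T \<psi> =
     Lim (at_right 0)
       (\<lambda>\<epsilon>. limsup (\<lambda>n. ln_ennreal (spanning_weight K T \<psi> n \<epsilon>) / ereal (real n)))"

section \<open>Skew product and inverse limit\<close>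

text \<open>
  The metrics on \<open>(nat \<Rightarrow> nat) \<times> 'a\<close> and \<open>(int \<Rightarrow> nat) \<times> (int \<Rightarrow> 'a)\<close> are the library's metrics on
  products and on functions with countable domain; both induce the product topology.
\<close>

definition one_sided :: "nat \<Rightarrow> (nat \<Rightarrow> nat) set" where
  "one_sided m = {\<omega>. \<forall>i. \<omega> i \<in> {1..m}}"

definition two_sided :: "nat \<Rightarrow> (int \<Rightarrow> nat) set" where
  "two_sided m = {\<eta>. \<forall>i. \<eta> i \<in> {1..m}}"

definition skew_product ::
    "(nat \<Rightarrow> 'a \<Rightarrow> 'a) \<Rightarrow> (nat \<Rightarrow> nat) \<times> 'a \<Rightarrow> (nat \<Rightarrow> nat) \<times> 'a" where
  "skew_product f = (\<lambda>(\<omega>, x). (\<lambda>i. \<omega> (i + 1), f (\<omega> 0) x))"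

definition skew_potential :: "(nat \<Rightarrow> 'a \<Rightarrow> real) \<Rightarrow> (nat \<Rightarrow> nat) \<times> 'a \<Rightarrow> real" where
  "skew_potential \<phi> = (\<lambda>(\<omega>, x). \<phi> (\<omega> 0) x)"

definition inverse_limit ::
    "nat \<Rightarrow> 'a set \<Rightarrow> (nat \<Rightarrow> 'a \<Rightarrow> 'a) \<Rightarrow> ((int \<Rightarrow> nat) \<times> (int \<Rightarrow> 'a)) set" where
  "inverse_limit m X f =
     {(\<eta>, x). \<eta> \<in> two_sided m \<and> (\<forall>j. x j \<in> X) \<and> (\<forall>j. x j = f (\<eta> (j - 1)) (x (j - 1)))}"

definition inverse_limit_shift ::
    "(int \<Rightarrow> nat) \<times> (int \<Rightarrow> 'a) \<Rightarrow> (int \<Rightarrow> nat) \<times> (int \<Rightarrow> 'a)" where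
  "inverse_limit_shift = (\<lambda>(\<eta>, x). (\<lambda>i. \<eta> (i + 1), \<lambda>i. x (i + 1)))"

definition inverse_limit_potential ::
    "(nat \<Rightarrow> 'a \<Rightarrow> real) \<Rightarrow> (int \<Rightarrow> nat) \<times> (int \<Rightarrow> 'a) \<Rightarrow> real" where
  "inverse_limit_potential \<phi> = (\<lambda>(\<eta>, x). \<phi> (\<eta> 0) (x 0))"

section \<open>Bowen balls and sums along words\<close>

definition words :: "nat \<Rightarrow> nat list set" where
  "words m = {C. C \<noteq> [] \<and> set C \<subseteq> {1..m}}"

text \<open>\<open>word_map f [j\<^sub>1, \<dots>, j\<^sub>n] = f j\<^sub>1 \<circ> \<dots> \<circ> f j\<^sub>n\<close>\<close>

definition word_map :: "(nat \<Rightarrow> 'a \<Rightarrow> 'a) \<Rightarrow> nat list \<Rightarrow> 'a \<Rightarrow> 'a" where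
  "word_map f C = foldr f C"

text \<open>
  In the next two definitions \<open>word_map f (rev (take k C))\<close> is
  \<open>f i\<^sub>k \<circ> \<dots> \<circ> f i\<^sub>1\<close> for \<open>C = [i\<^sub>1, \<dots>, i\<^sub>n]\<close>.
\<close>

definition word_ball ::
    "'a::metric_space set \<Rightarrow> (nat \<Rightarrow> 'a \<Rightarrow> 'a) \<Rightarrow> 'a \<Rightarrow> nat list \<Rightarrow> real \<Rightarrow> 'a set" where
  "word_ball X f y C \<epsilon> =
     {z\<in>X. dist y z < \<epsilon> \<and>
       (\<forall>k\<in>{1..length C}.
          dist (word_map f (rev (take k C)) y) (word_map f (rev (take k C)) z) < \<epsilon>)}"

definition word_sum ::
    "(nat \<Rightarrow> 'a \<Rightarrow> 'a) \<Rightarrow> (nat \<Rightarrow> 'a \<Rightarrow> real) \<Rightarrow> 'a \<Rightarrow> nat list \<Rightarrow> real" where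
  "word_sum f \<phi> y C = (\<Sum>k<length C. \<phi> (C ! k) (word_map f (rev (take k C)) y))"

definition seq_prefix :: "nat \<Rightarrow> (nat \<Rightarrow> nat) \<Rightarrow> nat list" where
  "seq_prefix n \<omega> = map \<omega> [0..<n]"

section \<open>Amalgamated pressure\<close>

definition amalg_covers ::
    "nat \<Rightarrow> 'a::metric_space set \<Rightarrow> (nat \<Rightarrow> 'a \<Rightarrow> 'a) \<Rightarrow> nat \<Rightarrow> real \<Rightarrow> (nat list \<times> 'a) set set" where
  "amalg_covers m X f N \<epsilon> =
     {\<Gamma>. \<Gamma> \<subseteq> words m \<times> X \<and> countable \<Gamma> \<and> X \<subseteq> (\<Union>(C, y)\<in>\<Gamma>. word_ball X f y C \<epsilon>) \<and>
         (\<forall>(C, y)\<in>\<Gamma>. N \<le> length C)}"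

definition amalg_M ::
    "nat \<Rightarrow> 'a::metric_space set \<Rightarrow> (nat \<Rightarrow> 'a \<Rightarrow> 'a) \<Rightarrow> (nat \<Rightarrow> 'a \<Rightarrow> real) \<Rightarrow> real \<Rightarrow> nat \<Rightarrow> real
      \<Rightarrow> ennreal" where
  "amalg_M m X f \<phi> s N \<epsilon> =
     (INF \<Gamma>\<in>amalg_covers m X f N \<epsilon>.
        \<Sum>\<^sub>\<infinity>(C, y)\<in>\<Gamma>. ennreal (exp (- s * real (length C) + word_sum f \<phi> y C)))"

definition amalg_m ::
    "nat \<Rightarrow> 'a::metric_space set \<Rightarrow> (nat \<Rightarrow> 'a \<Rightarrow> 'a) \<Rightarrow> (nat \<Rightarrow> 'a \<Rightarrow> real) \<Rightarrow> real \<Rightarrow> real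
      \<Rightarrow> ennreal" where
  "amalg_m m X f \<phi> s \<epsilon> = lim (\<lambda>N. amalg_M m X f \<phi> s N \<epsilon>)"

definition amalg_pressure_at ::
    "nat \<Rightarrow> 'a::metric_space set \<Rightarrow> (nat \<Rightarrow> 'a \<Rightarrow> 'a) \<Rightarrow> (nat \<Rightarrow> 'a \<Rightarrow> real) \<Rightarrow> real \<Rightarrow> ereal" where
  "amalg_pressure_at m X f \<phi> \<epsilon> = Inf {ereal s | s. amalg_m m X f \<phi> s \<epsilon> = 0}"

definition amalgamated_pressure ::
    "nat \<Rightarrow> 'a::metric_space set \<Rightarrow> (nat \<Rightarrow> 'a \<Rightarrow> 'a) \<Rightarrow> (nat \<Rightarrow> 'a \<Rightarrow> real) \<Rightarrow> ereal" where
  "amalgamated_pressure m X f \<phi> = Lim (at_right 0) (amalg_pressure_at m X f \<phi>)"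

section \<open>Upper condensed pressure\<close>

definition condensed_ball ::
    "nat \<Rightarrow> 'a::metric_space set \<Rightarrow> (nat \<Rightarrow> 'a \<Rightarrow> 'a) \<Rightarrow> nat \<Rightarrow> 'a \<Rightarrow> real \<Rightarrow> 'a set" where
  "condensed_ball m X f n x \<epsilon> = (\<Inter>\<omega>\<in>one_sided m. word_ball X f x (seq_prefix n \<omega>) \<epsilon>)"

definition upper_sum ::
    "nat \<Rightarrow> (nat \<Rightarrow> 'a \<Rightarrow> 'a) \<Rightarrow> (nat \<Rightarrow> 'a \<Rightarrow> real) \<Rightarrow> nat \<Rightarrow> 'a \<Rightarrow> real" where
  "upper_sum m f \<phi> n x = (SUP \<omega>\<in>one_sided m. word_sum f \<phi> x (seq_prefix n \<omega>))"

text \<open>A cover is a set of centers \<open>A\<close> together with the function assigning a length to each center.\<close>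

definition upper_covers ::
    "nat \<Rightarrow> 'a::metric_space set \<Rightarrow> (nat \<Rightarrow> 'a \<Rightarrow> 'a) \<Rightarrow> nat \<Rightarrow> real \<Rightarrow> ('a set \<times> ('a \<Rightarrow> nat)) set" where
  "upper_covers m X f N \<epsilon> =
     {(A, n). A \<subseteq> X \<and> countable A \<and> (\<forall>x\<in>A. N \<le> n x) \<and>
              X \<subseteq> (\<Union>x\<in>A. condensed_ball m X f (n x) x \<epsilon>)}"

definition upper_M ::
    "nat \<Rightarrow> 'a::metric_space set \<Rightarrow> (nat \<Rightarrow> 'a \<Rightarrow> 'a) \<Rightarrow> (nat \<Rightarrow> 'a \<Rightarrow> real) \<Rightarrow> real \<Rightarrow> nat \<Rightarrow> real
      \<Rightarrow> ennreal" where
  "upper_M m X f \<phi> s N \<epsilon> =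
     (INF (A, n)\<in>upper_covers m X f N \<epsilon>.
        \<Sum>\<^sub>\<infinity>x\<in>A. ennreal (exp (upper_sum m f \<phi> (n x) x - s * real (n x))))"

definition upper_m ::
    "nat \<Rightarrow> 'a::metric_space set \<Rightarrow> (nat \<Rightarrow> 'a \<Rightarrow> 'a) \<Rightarrow> (nat \<Rightarrow> 'a \<Rightarrow> real) \<Rightarrow> real \<Rightarrow> real
      \<Rightarrow> ennreal" where
  "upper_m m X f \<phi> s \<epsilon> = lim (\<lambda>N. upper_M m X f \<phi> s N \<epsilon>)"

definition upper_pressure_at ::
    "nat \<Rightarrow> 'a::metric_space set \<Rightarrow> (nat \<Rightarrow> 'a \<Rightarrow> 'a) \<Rightarrow> (nat \<Rightarrow> 'a \<Rightarrow> real) \<Rightarrow> real \<Rightarrow> ereal" where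
  "upper_pressure_at m X f \<phi> \<epsilon> = Inf {ereal s | s. upper_m m X f \<phi> s \<epsilon> = 0}"

definition upper_condensed_pressure ::
    "nat \<Rightarrow> 'a::metric_space set \<Rightarrow> (nat \<Rightarrow> 'a \<Rightarrow> 'a) \<Rightarrow> (nat \<Rightarrow> 'a \<Rightarrow> real) \<Rightarrow> ereal" where
  "upper_condensed_pressure m X f \<phi> = Lim (at_right 0) (upper_pressure_at m X f \<phi>)"

end

theory Submission
  imports Defs
begin

text \<open>
  All four pressures are suprema over the scale \<open>\<epsilon>\<close>, so exponential bounds at each fixed scale suffice.

  An \<open>\<epsilon>\<close>-spanning set of the skew product splits according to the first \<open>n\<close> symbols, and each of the
  \<open>m ^ n\<close> parts yields a cover of \<open>X\<close> by Bowen balls along one word. The lightest part has at most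
  \<open>1 / m ^ n\<close> of the total weight, which bounds the amalgamated pressure.

  For the upper bound, compactness gives a finite cover by condensed balls of varying lengths and total
  weight below \<open>1\<close>. Following any word, an orbit passes through these balls one after another, and the
  resulting renewal inequality bounds the weight of every orbit segment, uniformly over words.

  The skew product need not be surjective, so the projection of the inverse limit only covers the
  core \<open>\<Inter>n. F\<^sup>n K\<close>. As \<open>F\<^sup>q K\<close> lies in any given neighbourhood of the core for large \<open>q\<close>, the same
  renewal argument shows that spanning sets of the inverse limit control \<open>F\<close> on all of \<open>K\<close>. Conversely
  the orbit of a point under \<open>F\<close> determines the middle coordinates of any lift to the inverse limit.
\<close>

text \<open>Spanning sets do not concatenate at a fixed scale: a joined orbit follows two unrelated
  centres, and replacing these by one actual point enlarges the scale at every joint. The estimates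
  therefore run through finite families of sets, each set carrying an upper bound for the Birkhoff
  sums on it. Such families refine one another without loss, so blocks can be joined arbitrarily
  often. The price is paid once, when balls are turned into sets: distances at most double, and the
  rate rises by the oscillation \<delta> of the potential at that scale. The arbitrary margin
  \<delta> in the comparisons absorbs it. The renewal argument asks for blocks of total weight at
  most 1 after discounting at the target rate. A vanishing covering sum provides this for blocks of
  varying length, a light spanning set for blocks of one length.\<close>

section \<open>Monotone limits in the scale and in the minimal length\<close>

lemma Lim_at_right_0_antimono_eq_SUP:
  fixes g :: "real \<Rightarrow> ereal"
  assumes "\<And>a b. 0 < a \<Longrightarrow> a \<le> b \<Longrightarrow> g b \<le> g a"
  shows "Lim (at_right 0) g = (SUP \<epsilon>\<in>{0<..}. g \<epsilon>)"
proof (rule tendsto_Lim)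
  show "(g \<longlongrightarrow> (SUP \<epsilon>\<in>{0<..}. g \<epsilon>)) (at_right 0)"
  proof (rule order_tendstoI)
    fix a assume "a < (SUP \<epsilon>\<in>{0<..}. g \<epsilon>)"
    then obtain e where e: "0 < e" "a < g e"
      by (auto simp: less_SUP_iff)
    show "\<forall>\<^sub>F x in at_right 0. a < g x"
      using e assms by (auto simp: eventually_at_right_field intro!: exI[of _ e] intro: less_le_trans)
  next
    fix a assume a: "(SUP \<epsilon>\<in>{0<..}. g \<epsilon>) < a"
    show "\<forall>\<^sub>F x in at_right 0. g x < a"
      unfolding eventually_at_right_field
      by (rule exI[of _ 1]) (auto intro!: le_less_trans[OF SUP_upper a])
  qed
qed simp

text \<open>An increasing sequence stays below its limit. For the covering pressures this replaces
  the limit in \<open>N\<close> by a condition on each \<open>N\<close> separately.\<close>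

lemma lim_mono_eq_0_iff:
  fixes M :: "nat \<Rightarrow> ennreal"
  assumes "mono M"
  shows "lim M = 0 \<longleftrightarrow> (\<forall>N. M N = 0)"
proof -
  have "lim M = (SUP N. M N)"
    using LIMSEQ_SUP[OF assms] by (rule limI)
  then show ?thesis
    by (auto simp: SUP_eq_iff bot_ennreal[symmetric] simp del: bot_ennreal)
qed

section \<open>Exponential growth rates\<close>

lemma limsup_ln_ennreal_le:
  fixes q :: "nat \<Rightarrow> ennreal"
  assumes "\<forall>\<^sub>F n in sequentially. q n \<le> ennreal (D * exp (c * real n))"
  shows "limsup (\<lambda>n. ln_ennreal (q n) / ereal (real n)) \<le> ereal c"
proof -
  \<comment> \<open>Raising the constant to at least 1 makes \<open>ln D'\<close> usable whatever
    the sign of \<open>D\<close>; divided by \<open>n\<close> it vanishes in the limit.\<close>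
  define D' where "D' = max D 1"
  have D': "0 < D'" "D \<le> D'" by (auto simp: D'_def)
  have "\<forall>\<^sub>F n in sequentially. ln_ennreal (q n) / ereal (real n) \<le> ereal (ln D' / real n + c)"
    using assms eventually_gt_at_top[of 0]
  proof eventually_elim
    case (elim n)
    have le: "q n \<le> ennreal (D' * exp (c * real n))"
      using elim(1) by (rule order_trans) (use D' in \<open>auto intro!: ennreal_leI mult_right_mono\<close>)
    then have fin: "q n < \<infinity>"
      by (rule le_less_trans) (simp add: infinity_ennreal_def)
    show ?case
    proof (cases "q n = 0")
      case True
      with elim(2) show ?thesis by (simp add: ln_ennreal_def)
    next
      case False
      have pos: "0 < enn2real (q n)"
        using False fin by (simp add: enn2real_positive_iff zero_less_iff_neq_zero infinity_ennreal_def)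
      have "enn2real (q n) \<le> D' * exp (c * real n)"
        by (rule enn2real_leI) (use le D' in auto)
      with pos have "ln (enn2real (q n)) \<le> ln (D' * exp (c * real n))"
        using D' by (subst ln_le_cancel_iff) auto
      also have "\<dots> = ln D' + c * real n"
        using D' by (simp add: ln_mult)
      finally have "ln (enn2real (q n)) / real n \<le> ln D' / real n + c"
        using elim(2) by (simp add: field_simps)
      with False fin elim(2) show ?thesis by (simp add: ln_ennreal_def)
    qed
  qed
  then have "limsup (\<lambda>n. ln_ennreal (q n) / ereal (real n)) \<le> limsup (\<lambda>n. ereal (ln D' / real n + c))"
    by (rule Limsup_mono)
  also have "\<dots> = ereal c"
  proof (rule lim_imp_Limsup)
    have "(\<lambda>n. ln D' / real n + c) \<longlonglongrightarrow> 0 + c"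
      by (intro tendsto_add tendsto_const lim_const_over_n)
    then show "(\<lambda>n. ereal (ln D' / real n + c)) \<longlonglongrightarrow> ereal c" by simp
  qed simp
  finally show ?thesis .
qed

text \<open>The strict gap below \<open>c\<close> absorbs every constant, so the bound holds with
  factor 1 from some \<open>n\<close> on. The value \<infinity> is excluded there because its
  logarithm is not below \<open>c\<close>.\<close>

lemma eventually_less_exp_if_limsup_ln_ennreal_less:
  fixes q :: "nat \<Rightarrow> ennreal"
  assumes "limsup (\<lambda>n. ln_ennreal (q n) / ereal (real n)) < ereal c"
  shows "\<forall>\<^sub>F n in sequentially. q n < ennreal (exp (c * real n))"
  using Limsup_lessD[OF assms] eventually_gt_at_top[of 0]
proof eventually_elim
  case (elim n)
  show ?case
  proof (cases "q n = 0 \<or> q n = \<infinity>")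
    case True
    with elim show ?thesis by (auto simp: ln_ennreal_def)
  next
    case False
    then have pos: "0 < enn2real (q n)"
      by (simp add: enn2real_positive_iff zero_less_iff_neq_zero infinity_ennreal_def less_top)
    have "ln (enn2real (q n)) / real n < c"
      using elim False by (simp add: ln_ennreal_def)
    then have "ln (enn2real (q n)) < c * real n"
      using elim by (simp add: field_simps)
    then have "enn2real (q n) < exp (c * real n)"
      using pos by (metis exp_less_cancel_iff exp_ln)
    then have "ennreal (enn2real (q n)) < ennreal (exp (c * real n))"
      by (simp add: ennreal_less_iff)
    then show ?thesis
      using False by (simp add: infinity_ennreal_def less_top)
  qed
qed

section \<open>Pressure as a supremum\<close>

definition pressure_at ::
    "'b::metric_space set \<Rightarrow> ('b \<Rightarrow> 'b) \<Rightarrow> ('b \<Rightarrow> real) \<Rightarrow> real \<Rightarrow> ereal" where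
  "pressure_at K T \<psi> \<epsilon> = limsup (\<lambda>n. ln_ennreal (spanning_weight K T \<psi> n \<epsilon>) / ereal (real n))"

lemma ln_ennreal_mono:
  assumes "x \<le> y"
  shows "ln_ennreal x \<le> ln_ennreal y"
proof (cases "x = 0 \<or> y = \<infinity>")
  case True
  then show ?thesis by (auto simp: ln_ennreal_def)
next
  case False
  then have fin: "x < top" "y < top" and pos: "0 < x" "0 < y"
    using assms by (auto simp: infinity_ennreal_def less_top zero_less_iff_neq_zero top_unique)
  then have "0 < enn2real x" "enn2real x \<le> enn2real y"
    using assms by (auto simp: enn2real_positive_iff intro: enn2real_mono)
  then show ?thesis
    using fin pos by (auto simp: ln_ennreal_def)
qed

lemma spanning_mono:
  assumes "spanning K T n a E" "a \<le> b"
  shows "spanning K T n b E"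
proof -
  have "\<exists>y\<in>E. \<forall>i<n. dist ((T ^^ i) x) ((T ^^ i) y) \<le> b" if x: "x \<in> K" for x
  proof -
    from assms(1) x obtain y where "y \<in> E" "\<forall>i<n. dist ((T ^^ i) x) ((T ^^ i) y) \<le> a"
      unfolding spanning_def by blast
    with assms(2) show ?thesis by (intro bexI[of _ y]) (auto intro: order_trans[of _ a b])
  qed
  with assms(1) show ?thesis unfolding spanning_def by blast
qed

lemma spanning_weight_antimono:
  assumes "a \<le> b"
  shows "spanning_weight K T \<psi> n b \<le> spanning_weight K T \<psi> n a"
  unfolding spanning_weight_def
  by (rule INF_superset_mono) (use assms in \<open>auto intro: spanning_mono\<close>)

lemma topological_pressure_eq_SUP:
  "topological_pressure K T \<psi> = (SUP \<epsilon>\<in>{0<..}. pressure_at K T \<psi> \<epsilon>)"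
  unfolding topological_pressure_def pressure_at_def
proof (rule Lim_at_right_0_antimono_eq_SUP)
  fix a b :: real assume "a \<le> b"
  then have *: "ln_ennreal (spanning_weight K T \<psi> n b) / ereal (real n)
      \<le> ln_ennreal (spanning_weight K T \<psi> n a) / ereal (real n)" if "0 < n" for n
    using that by (intro ereal_divide_right_mono ln_ennreal_mono spanning_weight_antimono) auto
  show "limsup (\<lambda>n. ln_ennreal (spanning_weight K T \<psi> n b) / ereal (real n))
      \<le> limsup (\<lambda>n. ln_ennreal (spanning_weight K T \<psi> n a) / ereal (real n))"
    by (intro Limsup_mono eventually_mono[OF eventually_gt_at_top[of 0]] *)
qed

text \<open>All upper bounds on a topological pressure are proved in this form; \<open>D\<close> may
  depend on the scale.\<close>

lemma topological_pressure_leI: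
  assumes "\<And>\<epsilon>. 0 < \<epsilon> \<Longrightarrow>
    \<exists>D. \<forall>\<^sub>F n in sequentially. spanning_weight K T \<psi> n \<epsilon> \<le> ennreal (D * exp (c * real n))"
  shows "topological_pressure K T \<psi> \<le> ereal c"
  unfolding topological_pressure_eq_SUP pressure_at_def
proof (rule SUP_least)
  fix \<epsilon> :: real assume "\<epsilon> \<in> {0<..}"
  then obtain D where
    "\<forall>\<^sub>F n in sequentially. spanning_weight K T \<psi> n \<epsilon> \<le> ennreal (D * exp (c * real n))"
    using assms by auto
  then show "limsup (\<lambda>n. ln_ennreal (spanning_weight K T \<psi> n \<epsilon>) / ereal (real n)) \<le> ereal c"
    by (rule limsup_ln_ennreal_le)
qed

text \<open>The pressure at one scale is below the supremum over all scales, and an infimum strictly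
  below a number is undercut by an actual spanning set.\<close>

lemma eventually_spanning_if_topological_pressure_less:
  assumes "topological_pressure K T \<psi> < ereal c" "0 < \<epsilon>"
  shows "\<forall>\<^sub>F n in sequentially. \<exists>E. finite E \<and> spanning K T n \<epsilon> E \<and>
    (\<Sum>x\<in>E. exp (birkhoff_sum T \<psi> n x)) < exp (c * real n)"
proof -
  have "pressure_at K T \<psi> \<epsilon> < ereal c"
    using assms unfolding topological_pressure_eq_SUP
    by (intro le_less_trans[OF SUP_upper assms(1)[unfolded topological_pressure_eq_SUP]]) simp
  then have "\<forall>\<^sub>F n in sequentially. spanning_weight K T \<psi> n \<epsilon> < ennreal (exp (c * real n))"
    unfolding pressure_at_def by (rule eventually_less_exp_if_limsup_ln_ennreal_less)
  then show ?thesis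
    by eventually_elim (auto simp: spanning_weight_def INF_less_iff sum_nonneg ennreal_less_iff)
qed

section \<open>Weighted covers by sets with small orbit segments\<close>

text \<open>Sets instead of centres, and an upper bound \<open>w\<close> instead of the value at a
  centre: both survive intersection with the preimage of another such set. \<open>U\<close> is a
  relation rather than a distance so that in the skew product it can demand equal first symbols and
  small distance in \<open>X\<close>.\<close>

definition bowen_cover ::
    "('b \<Rightarrow> 'b) \<Rightarrow> ('b \<Rightarrow> real) \<Rightarrow> ('b \<Rightarrow> 'b \<Rightarrow> bool) \<Rightarrow> nat \<Rightarrow> 'b set \<Rightarrow> real \<Rightarrow> bool" where
  "bowen_cover T \<psi> U n S R \<longleftrightarrow> (\<exists>\<A>. finite \<A> \<and> S \<subseteq> (\<Union>(A, w)\<in>\<A>. A) \<and>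
     (\<forall>(A, w)\<in>\<A>. (\<forall>x\<in>A. \<forall>y\<in>A. \<forall>i<n. U ((T ^^ i) x) ((T ^^ i) y)) \<and>
        (\<forall>x\<in>A. birkhoff_sum T \<psi> n x \<le> w)) \<and>
     (\<Sum>(A, w)\<in>\<A>. exp w) \<le> R)"

lemma bowen_coverI:
  assumes "finite \<A>" "\<And>x. x \<in> S \<Longrightarrow> \<exists>(A, w)\<in>\<A>. x \<in> A"
    and "\<And>A w x y i. (A, w) \<in> \<A> \<Longrightarrow> x \<in> A \<Longrightarrow> y \<in> A \<Longrightarrow> i < n \<Longrightarrow> U ((T ^^ i) x) ((T ^^ i) y)"
    and "\<And>A w x. (A, w) \<in> \<A> \<Longrightarrow> x \<in> A \<Longrightarrow> birkhoff_sum T \<psi> n x \<le> w"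
    and "(\<Sum>(A, w)\<in>\<A>. exp w) \<le> R"
  shows "bowen_cover T \<psi> U n S R"
proof -
  have "S \<subseteq> (\<Union>(A, w)\<in>\<A>. A)"
  proof
    fix x assume "x \<in> S"
    with assms(2) obtain A w where "(A, w) \<in> \<A>" "x \<in> A" by blast
    then show "x \<in> (\<Union>(A, w)\<in>\<A>. A)" by auto
  qed
  moreover have "\<forall>(A, w)\<in>\<A>. (\<forall>x\<in>A. \<forall>y\<in>A. \<forall>i<n. U ((T ^^ i) x) ((T ^^ i) y)) \<and>
      (\<forall>x\<in>A. birkhoff_sum T \<psi> n x \<le> w)"
    using assms(3,4) by blast
  ultimately show ?thesis
    unfolding bowen_cover_def using assms(1,5) by blast
qed

lemma bowen_coverE:
  assumes "bowen_cover T \<psi> U n S R"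
  obtains \<A> where "finite \<A>" "\<And>x. x \<in> S \<Longrightarrow> \<exists>(A, w)\<in>\<A>. x \<in> A"
    and "\<And>A w x y i. (A, w) \<in> \<A> \<Longrightarrow> x \<in> A \<Longrightarrow> y \<in> A \<Longrightarrow> i < n \<Longrightarrow> U ((T ^^ i) x) ((T ^^ i) y)"
    and "\<And>A w x. (A, w) \<in> \<A> \<Longrightarrow> x \<in> A \<Longrightarrow> birkhoff_sum T \<psi> n x \<le> w"
    and "(\<Sum>(A, w)\<in>\<A>. exp w) \<le> R"
proof -
  from assms[unfolded bowen_cover_def] obtain \<A> where *:
    "finite \<A> \<and> S \<subseteq> (\<Union>(A, w)\<in>\<A>. A) \<and>
     (\<forall>(A, w)\<in>\<A>. (\<forall>x\<in>A. \<forall>y\<in>A. \<forall>i<n. U ((T ^^ i) x) ((T ^^ i) y)) \<and>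
        (\<forall>x\<in>A. birkhoff_sum T \<psi> n x \<le> w)) \<and>
     (\<Sum>(A, w)\<in>\<A>. exp w) \<le> R" ..
  show thesis
  proof (rule that[of \<A>])
    fix x assume "x \<in> S"
    with * have "x \<in> (\<Union>(A, w)\<in>\<A>. A)" by blast
    then show "\<exists>(A, w)\<in>\<A>. x \<in> A" by auto
  qed (use * in blast)+
qed

lemma bowen_cover_nonneg:
  assumes "bowen_cover T \<psi> U n S R"
  shows "0 \<le> R"
proof -
  from assms[unfolded bowen_cover_def] obtain \<A> :: "('a set \<times> real) set"
    where "(\<Sum>(A, w)\<in>\<A>. exp w) \<le> R" by blast
  moreover have "0 \<le> (\<Sum>(A, w)\<in>\<A>. exp w)"
    by (rule sum_nonneg) auto
  ultimately show ?thesis by linarith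
qed

lemma bowen_cover_mono:
  assumes "bowen_cover T \<psi> U n S R" "S' \<subseteq> S" "R \<le> R'"
  shows "bowen_cover T \<psi> U n S' R'"
  using assms(1)
proof (rule bowen_coverE)
  fix \<A> assume A: "finite \<A>" "\<And>x. x \<in> S \<Longrightarrow> \<exists>(A, w)\<in>\<A>. x \<in> A"
    "\<And>A w x y i. (A, w) \<in> \<A> \<Longrightarrow> x \<in> A \<Longrightarrow> y \<in> A \<Longrightarrow> i < n \<Longrightarrow> U ((T ^^ i) x) ((T ^^ i) y)"
    "\<And>A w x. (A, w) \<in> \<A> \<Longrightarrow> x \<in> A \<Longrightarrow> birkhoff_sum T \<psi> n x \<le> w" "(\<Sum>(A, w)\<in>\<A>. exp w) \<le> R"
  show ?thesis
  proof (rule bowen_coverI[of \<A>])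
    show "\<exists>(A, w)\<in>\<A>. x \<in> A" if "x \<in> S'" for x
      using that assms(2) A(2) by blast
    show "(\<Sum>(A, w)\<in>\<A>. exp w) \<le> R'"
      using A(5) assms(3) by linarith
  qed (fact A)+
qed

lemma bowen_cover_0: "bowen_cover T \<psi> U 0 S 1"
  unfolding bowen_cover_def
  by (rule exI[of _ "{(S, 0)}"]) (auto simp: birkhoff_sum_def)

lemma bowen_cover_empty: "0 \<le> R \<Longrightarrow> bowen_cover T \<psi> U n {} R"
  unfolding bowen_cover_def by (rule exI[of _ "{}"]) auto

lemma bowen_cover_Un:
  assumes "bowen_cover T \<psi> U n S R" "bowen_cover T \<psi> U n S' R'"
  shows "bowen_cover T \<psi> U n (S \<union> S') (R + R')"
proof -
  obtain \<A> where A: "finite \<A>" "\<And>x. x \<in> S \<Longrightarrow> \<exists>(A, w)\<in>\<A>. x \<in> A"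
    "\<And>A w x y i. (A, w) \<in> \<A> \<Longrightarrow> x \<in> A \<Longrightarrow> y \<in> A \<Longrightarrow> i < n \<Longrightarrow> U ((T ^^ i) x) ((T ^^ i) y)"
    "\<And>A w x. (A, w) \<in> \<A> \<Longrightarrow> x \<in> A \<Longrightarrow> birkhoff_sum T \<psi> n x \<le> w" "(\<Sum>(A, w)\<in>\<A>. exp w) \<le> R"
    using bowen_coverE[OF assms(1)] by blast
  obtain \<B> where B: "finite \<B>" "\<And>x. x \<in> S' \<Longrightarrow> \<exists>(A, w)\<in>\<B>. x \<in> A"
    "\<And>A w x y i. (A, w) \<in> \<B> \<Longrightarrow> x \<in> A \<Longrightarrow> y \<in> A \<Longrightarrow> i < n \<Longrightarrow> U ((T ^^ i) x) ((T ^^ i) y)"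
    "\<And>A w x. (A, w) \<in> \<B> \<Longrightarrow> x \<in> A \<Longrightarrow> birkhoff_sum T \<psi> n x \<le> w" "(\<Sum>(A, w)\<in>\<B>. exp w) \<le> R'"
    using bowen_coverE[OF assms(2)] by blast
  have "(\<Sum>(A, w)\<in>\<A> \<union> \<B>. exp w) \<le> (\<Sum>(A, w)\<in>\<A>. exp w) + (\<Sum>(A, w)\<in>\<B>. exp w)"
    by (subst sum_Un) (use A(1) B(1) in \<open>auto intro!: sum_nonneg\<close>)
  then have "(\<Sum>(A, w)\<in>\<A> \<union> \<B>. exp w) \<le> R + R'" using A(5) B(5) by linarith
  then show ?thesis
  proof (intro bowen_coverI[of "\<A> \<union> \<B>"])
    fix x assume "x \<in> S \<union> S'"
    then show "\<exists>(A, w)\<in>\<A> \<union> \<B>. x \<in> A"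
      using A(2) B(2) by blast
  qed (use A(1,3,4) B(1,3,4) in \<open>auto split: if_splits\<close>)
qed

lemma bowen_cover_UN:
  assumes "finite I" "\<And>i. i \<in> I \<Longrightarrow> bowen_cover T \<psi> U n (D i) (R i)"
  shows "bowen_cover T \<psi> U n (\<Union>i\<in>I. D i) (\<Sum>i\<in>I. R i)"
  using assms by (induction I rule: finite_induct) (auto intro!: bowen_cover_Un bowen_cover_empty)

lemma birkhoff_sum_add:
  "birkhoff_sum T \<psi> (n + k) x = birkhoff_sum T \<psi> n x + birkhoff_sum T \<psi> k ((T ^^ n) x)"
proof (induction k)
  case (Suc k)
  have "(T ^^ (n + k)) x = (T ^^ k) ((T ^^ n) x)"
    by (metis add.commute comp_apply funpow_add)
  with Suc show ?case by (simp add: birkhoff_sum_def)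
qed (simp add: birkhoff_sum_def)

text \<open>Refine the first cover by the preimages under \<open>T ^^ n\<close> of the second.
  Birkhoff sums add along the orbit, so the weights of a pair multiply, and summing over all pairs
  gives the product of the totals.\<close>

lemma bowen_cover_concat:
  assumes "bowen_cover T \<psi> U n S R" "bowen_cover T \<psi> U k S' R'" "(T ^^ n) ` S \<subseteq> S'"
  shows "bowen_cover T \<psi> U (n + k) S (R * R')"
proof -
  obtain \<A> where A: "finite \<A>" "\<And>x. x \<in> S \<Longrightarrow> \<exists>(A, w)\<in>\<A>. x \<in> A"
    "\<And>A w x y i. (A, w) \<in> \<A> \<Longrightarrow> x \<in> A \<Longrightarrow> y \<in> A \<Longrightarrow> i < n \<Longrightarrow> U ((T ^^ i) x) ((T ^^ i) y)"
    "\<And>A w x. (A, w) \<in> \<A> \<Longrightarrow> x \<in> A \<Longrightarrow> birkhoff_sum T \<psi> n x \<le> w" "(\<Sum>(A, w)\<in>\<A>. exp w) \<le> R"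
    using bowen_coverE[OF assms(1)] by blast
  obtain \<B> where B: "finite \<B>" "\<And>x. x \<in> S' \<Longrightarrow> \<exists>(A, w)\<in>\<B>. x \<in> A"
    "\<And>A w x y i. (A, w) \<in> \<B> \<Longrightarrow> x \<in> A \<Longrightarrow> y \<in> A \<Longrightarrow> i < k \<Longrightarrow> U ((T ^^ i) x) ((T ^^ i) y)"
    "\<And>A w x. (A, w) \<in> \<B> \<Longrightarrow> x \<in> A \<Longrightarrow> birkhoff_sum T \<psi> k x \<le> w" "(\<Sum>(A, w)\<in>\<B>. exp w) \<le> R'"
    using bowen_coverE[OF assms(2)] by blast
  define h where "h = (\<lambda>((A, w), (B, v)). (A \<inter> (T ^^ n) -` B, w + v :: real))"
  show ?thesis
  proof (rule bowen_coverI)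
    show "finite (h ` (\<A> \<times> \<B>))"
      using A(1) B(1) by simp
    \<comment> \<open>Several pairs may yield the same set and bound; counting it once only lowers
      the sum.\<close>
    have "(\<Sum>(A, w)\<in>h ` (\<A> \<times> \<B>). exp w) \<le> (\<Sum>p\<in>\<A> \<times> \<B>. exp (snd (h p)))"
      unfolding case_prod_beta
      using sum_image_le[of "\<A> \<times> \<B>" "\<lambda>p. exp (snd p)" h] A(1) B(1) by (simp add: comp_def)
    also have "\<dots> = (\<Sum>(A, w)\<in>\<A>. exp w) * (\<Sum>(A, w)\<in>\<B>. exp w)"
      by (simp add: sum_product sum.cartesian_product h_def case_prod_beta exp_add)
    also have "\<dots> \<le> R * R'"
      using A(5) B(5) bowen_cover_nonneg[OF assms(1)]
      by (intro mult_mono) (auto intro!: sum_nonneg)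
    finally show "(\<Sum>(A, w)\<in>h ` (\<A> \<times> \<B>). exp w) \<le> R * R'" .
  next
    fix x assume x: "x \<in> S"
    then obtain A w where Aw: "(A, w) \<in> \<A>" "x \<in> A" using A(2) by blast
    from x assms(3) have "(T ^^ n) x \<in> S'" by auto
    then obtain B v where Bv: "(B, v) \<in> \<B>" "(T ^^ n) x \<in> B" using B(2) by blast
    show "\<exists>(A, w)\<in>h ` (\<A> \<times> \<B>). x \<in> A"
      using Aw Bv by (intro bexI[of _ "h ((A, w), (B, v))"] imageI) (auto simp: h_def)
  next
    fix C u x y i
    assume "(C, u) \<in> h ` (\<A> \<times> \<B>)" and xy: "x \<in> C" "y \<in> C" and i: "i < n + k"
    then obtain A w B v where *: "(A, w) \<in> \<A>" "(B, v) \<in> \<B>" "C = A \<inter> (T ^^ n) -` B"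
      by (auto simp: h_def)
    show "U ((T ^^ i) x) ((T ^^ i) y)"
    proof (cases "i < n")
      case True
      then show ?thesis using xy * A(3) by blast
    next
      case False
      then obtain j where j: "i = j + n" "j < k"
        using i by (metis add.commute add_less_cancel_left le_Suc_ex not_less)
      have "U ((T ^^ j) ((T ^^ n) x)) ((T ^^ j) ((T ^^ n) y))"
        using xy * j(2) by (intro B(3)[of B v]) auto
      then show ?thesis by (simp add: j funpow_add)
    qed
  next
    fix C u x
    assume "(C, u) \<in> h ` (\<A> \<times> \<B>)" and x: "x \<in> C"
    then obtain A w B v where *: "(A, w) \<in> \<A>" "(B, v) \<in> \<B>" "x \<in> A" "(T ^^ n) x \<in> B" "u = w + v"
      by (auto simp: h_def)
    then show "birkhoff_sum T \<psi> (n + k) x \<le> u"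
      unfolding birkhoff_sum_add using A(4)[OF *(1,3)] B(4)[OF *(2,4)] by simp
  qed
qed

lemma funpow_image_subset: "T ` S \<subseteq> S \<Longrightarrow> (T ^^ n) ` S \<subseteq> S"
  by (induction n) (auto simp: image_subset_iff)

section \<open>Repeated concatenation and the renewal inequality\<close>

lemma bowen_cover_power:
  assumes "bowen_cover T \<psi> U 1 S R" "T ` S \<subseteq> S"
  shows "bowen_cover T \<psi> U n S (R ^ n)"
proof (induction n)
  case (Suc n)
  show ?case
    using bowen_cover_concat[OF assms(1) Suc] assms(2) by simp
qed (simp add: bowen_cover_0)

text \<open>A segment of length \<open>n\<close> that starts in \<open>D i\<close> consists of a
  block of length \<open>l i\<close> and a segment of length \<open>n - l i\<close> that starts in
  \<open>S\<close>. Writing \<open>a n\<close> for the weight needed at length \<open>n\<close>,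
  this is a renewal inequality bounding \<open>a n\<close> by the sum of
  \<open>R i * a (n - l i)\<close>. The hypothesis \<open>sum\<close> makes
  \<open>B * exp (c * n)\<close> a supersolution, so strong induction reproduces the same
  \<open>B\<close>.\<close>

lemma bowen_cover_renewal:
  assumes inv: "T ` S \<subseteq> S" and one: "bowen_cover T \<psi> U 1 S R0"
    and I: "finite I" "S \<subseteq> (\<Union>i\<in>I. D i)"
    and D: "\<And>i. i \<in> I \<Longrightarrow> D i \<subseteq> S" "\<And>i. i \<in> I \<Longrightarrow> 0 < l i"
      "\<And>i. i \<in> I \<Longrightarrow> bowen_cover T \<psi> U (l i) (D i) (R i)"
    and sum: "(\<Sum>i\<in>I. R i * exp (- c * real (l i))) \<le> 1"
  shows "\<exists>B. \<forall>n. bowen_cover T \<psi> U n S (B * exp (c * real n))"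
proof -
  \<comment> \<open>Lengths up to the longest block are handled by powers of the one-step cover, for
    which \<open>b n\<close> is the constant needed at length \<open>n\<close>. Summing these
    constants dominates each of them; beyond that range every block fits into
    \<open>n\<close>.\<close>
  define b where "b = (\<lambda>n. R0 ^ n * exp (- c * real n))"
  define B where "B = (\<Sum>n\<le>Max (l ` I). b n)"
  have R0: "0 \<le> R0" using one by (rule bowen_cover_nonneg)
  then have b0: "0 \<le> b n" for n by (simp add: b_def)
  then have B0: "0 \<le> B" by (simp add: B_def sum_nonneg)
  have "bowen_cover T \<psi> U n S (B * exp (c * real n))" for n
  proof (induction n rule: less_induct)
    case (less n)
    show ?case
    proof (cases "n \<le> Max (l ` I)")
      case True
      then have "b n \<le> B"
        unfolding B_def using b0 by (intro member_le_sum) auto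
      then have "R0 ^ n \<le> B * exp (c * real n)"
        by (simp add: b_def exp_minus field_simps)
      with bowen_cover_power[OF one inv] show ?thesis by (blast intro: bowen_cover_mono)
    next
      case False
      have "bowen_cover T \<psi> U n (D i) (R i * (B * exp (c * real (n - l i))))" if i: "i \<in> I" for i
      proof -
        have le: "l i \<le> n"
          using False i I(1) by (meson Max_ge finite_imageI imageI le_trans nat_le_linear)
        have "bowen_cover T \<psi> U (l i + (n - l i)) (D i) (R i * (B * exp (c * real (n - l i))))"
        proof (rule bowen_cover_concat)
          show "bowen_cover T \<psi> U (n - l i) S (B * exp (c * real (n - l i)))"
            using D(2)[OF i] le by (intro less) auto
          show "(T ^^ l i) ` D i \<subseteq> S"
            using funpow_image_subset[OF inv] D(1)[OF i] by blast
        qed (rule D(3)[OF i])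
        with le show ?thesis by simp
      qed
      from bowen_cover_UN[OF I(1) this]
      show ?thesis
      proof (rule bowen_cover_mono)
        \<comment> \<open>Pulling out \<open>B * exp (c * n)\<close> leaves exactly the sum that is
          assumed to be at most 1.\<close>
        have "(\<Sum>i\<in>I. R i * (B * exp (c * real (n - l i))))
              = B * exp (c * real n) * (\<Sum>i\<in>I. R i * exp (- c * real (l i)))"
          unfolding sum_distrib_left
        proof (rule sum.cong)
          fix i assume i: "i \<in> I"
          then have "l i \<le> n"
            using False I(1) by (meson Max_ge finite_imageI imageI le_trans nat_le_linear)
          then have "exp (c * real (n - l i)) = exp (c * real n) * exp (- c * real (l i))"
            by (simp add: of_nat_diff algebra_simps flip: exp_add)
          then show "R i * (B * exp (c * real (n - l i))) = B * exp (c * real n) * (R i * exp (- c * real (l i)))"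
            by simp
        qed simp
        also have "\<dots> \<le> B * exp (c * real n) * 1"
          using B0 by (intro mult_left_mono sum) auto
        finally show "(\<Sum>i\<in>I. R i * (B * exp (c * real (n - l i)))) \<le> B * exp (c * real n)" by simp
      qed (use I(2) in auto)
    qed
  qed
  then show ?thesis by blast
qed

text \<open>Spanning sets enter here. Two points following the same centre are
  \<open>U\<close>-related through it, and their Birkhoff sums exceed that of the centre by at most
  \<delta> per step.\<close>

lemma bowen_cover_balls:
  assumes "finite E"
    and "\<And>x y z. V x z \<Longrightarrow> V y z \<Longrightarrow> U x y"
    and "\<And>x z. V x z \<Longrightarrow> \<psi> x \<le> \<psi> z + \<delta>"
  shows "bowen_cover T \<psi> U n (\<Union>e\<in>E. {x. \<forall>i<n. V ((T ^^ i) x) ((T ^^ i) e)})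
    (exp (\<delta> * real n) * (\<Sum>e\<in>E. exp (birkhoff_sum T \<psi> n e)))"
proof -
  define h where "h = (\<lambda>e. ({x. \<forall>i<n. V ((T ^^ i) x) ((T ^^ i) e)}, birkhoff_sum T \<psi> n e + \<delta> * real n))"
  show ?thesis
  proof (rule bowen_coverI)
    show "finite (h ` E)"
      using assms(1) by simp
    have "(\<Sum>(A, w)\<in>h ` E. exp w) \<le> (\<Sum>e\<in>E. exp (snd (h e)))"
      unfolding case_prod_beta
      using sum_image_le[of E "\<lambda>p. exp (snd p)" h] assms(1) by (simp add: comp_def)
    also have "\<dots> = exp (\<delta> * real n) * (\<Sum>e\<in>E. exp (birkhoff_sum T \<psi> n e))"
      by (simp add: h_def exp_add sum_distrib_left mult.commute)
    finally show "(\<Sum>(A, w)\<in>h ` E. exp w) \<le> exp (\<delta> * real n) * (\<Sum>e\<in>E. exp (birkhoff_sum T \<psi> n e))" .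
  next
    fix A w x assume "(A, w) \<in> h ` E" "x \<in> A"
    then obtain e where e: "\<And>i. i < n \<Longrightarrow> V ((T ^^ i) x) ((T ^^ i) e)"
        "w = birkhoff_sum T \<psi> n e + \<delta> * real n"
      by (auto simp: h_def)
    have "birkhoff_sum T \<psi> n x \<le> (\<Sum>i<n. \<psi> ((T ^^ i) e) + \<delta>)"
      unfolding birkhoff_sum_def using e(1) by (intro sum_mono assms(3)) auto
    then show "birkhoff_sum T \<psi> n x \<le> w"
      by (simp add: e(2) birkhoff_sum_def sum.distrib mult.commute)
  next
    fix A w x y i assume "(A, w) \<in> h ` E" "x \<in> A" "y \<in> A" "i < n"
    then show "U ((T ^^ i) x) ((T ^^ i) y)"
      unfolding h_def using assms(2) by blast
  qed (auto simp: h_def)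
qed

section \<open>Comparison of pressures under semiconjugacies\<close>

lemma funpow_semiconj:
  assumes "\<And>u. u \<in> K' \<Longrightarrow> T' u \<in> K'" "\<And>u. u \<in> K' \<Longrightarrow> p (T' u) = T (p u)" "u \<in> K'"
  shows "(T' ^^ i) u \<in> K'" "p ((T' ^^ i) u) = (T ^^ i) (p u)"
  using assms by (induction i) auto

lemma birkhoff_sum_semiconj:
  assumes "\<And>u. u \<in> K' \<Longrightarrow> T' u \<in> K'" "\<And>u. u \<in> K' \<Longrightarrow> p (T' u) = T (p u)" "u \<in> K'"
  shows "birkhoff_sum T' (\<psi> \<circ> p) n u = birkhoff_sum T \<psi> n (p u)"
  using funpow_semiconj(2)[of K' T' p T, OF assms] by (simp add: birkhoff_sum_def)

lemma birkhoff_sum_ge: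
  assumes "T ` K \<subseteq> K" "\<And>x. x \<in> K \<Longrightarrow> - B \<le> \<psi> x" "x \<in> K"
  shows "- (B * real n) \<le> birkhoff_sum T \<psi> n x"
proof -
  have "(\<Sum>i<n. - B) \<le> birkhoff_sum T \<psi> n x"
    unfolding birkhoff_sum_def
    using funpow_image_subset[OF assms(1)] assms(2,3) by (intro sum_mono) auto
  then show ?thesis by (simp add: mult.commute)
qed

text \<open>The way back from covers to spanning sets, possibly in an extension: choose one point of
  \<open>K'\<close> above each set of the cover. By \<open>gen\<close>, base positions at times up
  to \<open>l\<close> control the distance upstairs, but only after \<open>k\<close> steps, since
  coordinates of the past become visible in the base only after a shift. The cover therefore has
  length \<open>n + l\<close>, and the \<open>l\<close> surplus terms cost a factor
  \<open>exp (B * l)\<close> independent of \<open>n\<close>.\<close>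

lemma spanning_weight_le_bowen_cover:
  fixes K' :: "'c::metric_space set"
  assumes cov: "bowen_cover T \<psi> U (n + l) K R" and inv: "T ` K \<subseteq> K"
    and maps: "\<And>u. u \<in> K' \<Longrightarrow> T' u \<in> K'" and semi: "\<And>u. u \<in> K' \<Longrightarrow> p (T' u) = T (p u)"
    and into: "\<And>u. u \<in> K' \<Longrightarrow> p u \<in> K" and onto: "K' \<subseteq> (T' ^^ k) ` K'" and "k \<le> l"
    and gen: "\<And>u v. u \<in> K' \<Longrightarrow> v \<in> K' \<Longrightarrow> (\<And>j. j \<le> l \<Longrightarrow> U ((T ^^ j) (p u)) ((T ^^ j) (p v)))
        \<Longrightarrow> dist ((T' ^^ k) u) ((T' ^^ k) v) \<le> \<epsilon>"
    and bound: "\<And>x. x \<in> K \<Longrightarrow> - B \<le> \<psi> x"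
  shows "spanning_weight K' T' (\<psi> \<circ> p) n \<epsilon> \<le> ennreal (R * exp (B * real l))"
proof -
  obtain \<A> where A: "finite \<A>" "\<And>x. x \<in> K \<Longrightarrow> \<exists>(A, w)\<in>\<A>. x \<in> A"
    "\<And>A w x y i. (A, w) \<in> \<A> \<Longrightarrow> x \<in> A \<Longrightarrow> y \<in> A \<Longrightarrow> i < n + l \<Longrightarrow> U ((T ^^ i) x) ((T ^^ i) y)"
    "\<And>A w x. (A, w) \<in> \<A> \<Longrightarrow> x \<in> A \<Longrightarrow> birkhoff_sum T \<psi> (n + l) x \<le> w"
    "(\<Sum>(A, w)\<in>\<A>. exp w) \<le> R"
    using bowen_coverE[OF cov] by blast
  \<comment> \<open>Only sets with a point of \<open>K'\<close> above them can supply a centre;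
    dropping the others lowers the weight.\<close>
  define \<B> where "\<B> = {P\<in>\<A>. \<exists>u\<in>K'. p u \<in> fst P}"
  define g where "g = (\<lambda>P :: 'a set \<times> real. SOME u. u \<in> K' \<and> p u \<in> fst P)"
  have g: "g P \<in> K'" "p (g P) \<in> fst P" if "P \<in> \<B>" for P
    using that someI_ex[of "\<lambda>u. u \<in> K' \<and> p u \<in> fst P"] unfolding \<B>_def g_def by blast+
  have finB: "finite \<B>" using A(1) by (simp add: \<B>_def)
  have sc: "(T' ^^ i) u \<in> K'" "p ((T' ^^ i) u) = (T ^^ i) (p u)" if "u \<in> K'" for u i
    using funpow_semiconj[of K' T' p T u i] maps semi that by blast+
  \<comment> \<open>The centres are moved forward \<open>k\<close> steps because \<open>gen\<close>
    compares only such images; \<open>onto\<close> presents every point of \<open>K'\<close> as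
    one.\<close>
  define E where "E = (\<lambda>P. (T' ^^ k) (g P)) ` \<B>"
  have "spanning K' T' n \<epsilon> E"
    unfolding spanning_def
  proof (intro conjI ballI)
    show "E \<subseteq> K'" using g(1) sc(1) by (auto simp: E_def)
    fix z assume "z \<in> K'"
    with onto obtain u where u: "u \<in> K'" "z = (T' ^^ k) u" by blast
    from A(2)[OF into[OF u(1)]] obtain A w where Aw: "(A, w) \<in> \<A>" "p u \<in> A" by blast
    define v where "v = g (A, w)"
    have AwB: "(A, w) \<in> \<B>" using Aw u(1) by (auto simp: \<B>_def)
    then have v: "v \<in> K'" "p v \<in> A" using g[OF AwB] by (auto simp: v_def)
    show "\<exists>y\<in>E. \<forall>i<n. dist ((T' ^^ i) z) ((T' ^^ i) y) \<le> \<epsilon>"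
    proof (intro bexI[of _ "(T' ^^ k) v"] allI impI)
      show "(T' ^^ k) v \<in> E" using AwB by (auto simp: E_def v_def)
      fix i assume i: "i < n"
      have "dist ((T' ^^ k) ((T' ^^ i) u)) ((T' ^^ k) ((T' ^^ i) v)) \<le> \<epsilon>"
      proof (rule gen)
        fix j assume j: "j \<le> l"
        have "U ((T ^^ (j + i)) (p u)) ((T ^^ (j + i)) (p v))"
          using A(3)[OF Aw(1) Aw(2) v(2), of "j + i"] i j by simp
        then show "U ((T ^^ j) (p ((T' ^^ i) u))) ((T ^^ j) (p ((T' ^^ i) v)))"
          using sc(2) u(1) v(1) by (simp add: funpow_add)
      qed (use sc(1) u(1) v(1) in auto)
      moreover have "(T' ^^ k) ((T' ^^ i) x) = (T' ^^ i) ((T' ^^ k) x)" for x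
        by (metis add.commute comp_apply funpow_add)
      ultimately show "dist ((T' ^^ i) z) ((T' ^^ i) ((T' ^^ k) v)) \<le> \<epsilon>"
        by (simp add: u(2))
    qed
  qed
  moreover have "finite E" using finB by (simp add: E_def)
  ultimately have "spanning_weight K' T' (\<psi> \<circ> p) n \<epsilon> \<le> (\<Sum>x\<in>E. ennreal (exp (birkhoff_sum T' (\<psi> \<circ> p) n x)))"
    unfolding spanning_weight_def by (intro INF_lower) auto
  also have "\<dots> \<le> (\<Sum>P\<in>\<B>. ennreal (exp (birkhoff_sum T' (\<psi> \<circ> p) n ((T' ^^ k) (g P)))))"
    unfolding E_def
    using sum_image_le[OF finB, of "\<lambda>x. ennreal (exp (birkhoff_sum T' (\<psi> \<circ> p) n x))" "\<lambda>P. (T' ^^ k) (g P)"]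
    by (simp add: comp_def)
  also have "\<dots> \<le> (\<Sum>P\<in>\<B>. ennreal (exp (snd P) * exp (B * real l)))"
  proof (intro sum_mono ennreal_leI)
    fix P assume P: "P \<in> \<B>"
    define x where "x = p (g P)"
    have x: "x \<in> K" using g(1)[OF P] into by (simp add: x_def)
    have "birkhoff_sum T' (\<psi> \<circ> p) n ((T' ^^ k) (g P)) = birkhoff_sum T \<psi> n ((T ^^ k) x)"
      using birkhoff_sum_semiconj[of K' T' p T, OF maps semi] sc g(1)[OF P] by (simp add: x_def)
    \<comment> \<open>Of the \<open>n + l\<close> terms, the \<open>n\<close> terms from time
      \<open>k\<close> on form the sum of the centre. The first \<open>k\<close> and the last
      \<open>l - k\<close> terms are at least \<open>- B\<close> each.\<close>
    moreover have "birkhoff_sum T \<psi> (n + l) x = birkhoff_sum T \<psi> k x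
        + (birkhoff_sum T \<psi> n ((T ^^ k) x) + birkhoff_sum T \<psi> (l - k) ((T ^^ n) ((T ^^ k) x)))"
    proof -
      have "n + l = k + (n + (l - k))" using \<open>k \<le> l\<close> by simp
      then show ?thesis by (simp only: birkhoff_sum_add)
    qed
    moreover have "- (B * real k) \<le> birkhoff_sum T \<psi> k x"
      by (rule birkhoff_sum_ge[OF inv bound x])
    moreover have "- (B * real (l - k)) \<le> birkhoff_sum T \<psi> (l - k) ((T ^^ n) ((T ^^ k) x))"
      using funpow_image_subset[OF inv] x by (intro birkhoff_sum_ge[OF inv bound]) blast+
    moreover have "B * real (l - k) = B * real l - B * real k"
      using \<open>k \<le> l\<close> by (simp add: of_nat_diff algebra_simps)
    moreover have "birkhoff_sum T \<psi> (n + l) x \<le> snd P"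
      using A(4)[of "fst P" "snd P" x] P g(2)[OF P] by (simp add: \<B>_def x_def)
    ultimately have "birkhoff_sum T' (\<psi> \<circ> p) n ((T' ^^ k) (g P)) \<le> snd P + B * real l"
      by linarith
    then show "exp (birkhoff_sum T' (\<psi> \<circ> p) n ((T' ^^ k) (g P))) \<le> exp (snd P) * exp (B * real l)"
      by (simp flip: exp_add)
  qed
  also have "\<dots> = ennreal ((\<Sum>P\<in>\<B>. exp (snd P)) * exp (B * real l))"
    by (simp add: sum_distrib_right)
  also have "\<dots> \<le> ennreal (R * exp (B * real l))"
  proof (intro ennreal_leI mult_right_mono)
    have "(\<Sum>P\<in>\<B>. exp (snd P)) \<le> (\<Sum>P\<in>\<A>. exp (snd P))"
      using A(1) by (intro sum_mono2) (auto simp: \<B>_def)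
    then show "(\<Sum>P\<in>\<B>. exp (snd P)) \<le> R" using A(5) by (simp add: case_prod_beta)
  qed simp
  finally show ?thesis .
qed

section \<open>Compactness, uniform continuity and margins\<close>

text \<open>Finite intersection property for the parts outside \<open>W\<close>: finitely many
  members of a decreasing sequence all contain the one of largest index.\<close>

lemma decreasing_compacts_subset_open:
  fixes F :: "nat \<Rightarrow> 'a::t2_space set"
  assumes "\<And>n. compact (F n)" "decseq F" "open W" "(\<Inter>n. F n) \<subseteq> W"
  shows "\<exists>n. F n \<subseteq> W"
proof (rule ccontr)
  assume no: "\<nexists>n. F n \<subseteq> W"
  have "(F 0 - W) \<inter> (\<Inter>n\<in>UNIV. F n) \<noteq> {}"
  proof (rule compact_imp_fip_image)
    show "compact (F 0 - W)" using assms by (simp add: compact_diff)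
    show "closed (F n)" for n using assms(1) by (rule compact_imp_closed)
    fix I :: "nat set" assume I: "finite I"
    \<comment> \<open>Inserting 0 covers empty \<open>I\<close> and also places the chosen point in
      \<open>F 0\<close>.\<close>
    define N where "N = Max (insert 0 I)"
    obtain x where x: "x \<in> F N" "x \<notin> W" using no by blast
    have "F N \<subseteq> F i" if "i \<in> insert 0 I" for i
      using assms(2) I that by (auto simp: decseq_def N_def)
    then show "(F 0 - W) \<inter> (\<Inter>n\<in>I. F n) \<noteq> {}" using x by blast
  qed
  with assms(4) show False by blast
qed

lemma continuous_on_funpow:
  assumes "continuous_on K T" "T ` K \<subseteq> K"
  shows "continuous_on K (T ^^ n)"
proof (induction n)
  case (Suc n)
  have "continuous_on K (\<lambda>x. T ((T ^^ n) x))"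
    using assms(1) Suc funpow_image_subset[OF assms(2)] by (rule continuous_on_compose2)
  then show ?case by simp
qed (simp add: id_def)

lemma decseq_funpow_image: "T ` K \<subseteq> K \<Longrightarrow> decseq (\<lambda>n. (T ^^ n) ` K)"
proof (rule decseq_SucI)
  fix n assume "T ` K \<subseteq> K"
  then have "(T ^^ n) ` (T ` K) \<subseteq> (T ^^ n) ` K" by (rule image_mono)
  then show "(T ^^ Suc n) ` K \<subseteq> (T ^^ n) ` K" by (simp add: funpow_Suc_right image_comp del: funpow.simps)
qed

text \<open>Provides two margins: \<open>c\<close> strictly above \<open>B\<close>, from which light
  covers are extracted, and \<delta> for what is lost in transferring them. If \<open>A\<close>
  exceeded \<open>B\<close>, two reals between them would supply \<open>c\<close> and a \<delta>
  that contradict each other.\<close>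

lemma ereal_le_if_le_add_real:
  fixes A B :: ereal
  assumes "\<And>c \<delta>. B < ereal c \<Longrightarrow> 0 < \<delta> \<Longrightarrow> A \<le> ereal (c + \<delta>)"
  shows "A \<le> B"
proof (rule ccontr)
  assume "\<not> A \<le> B"
  then have "B < A" by simp
  then obtain c where c: "B < ereal c" "ereal c < A" using ereal_dense2 by blast
  from c(2) obtain d where d: "ereal c < ereal d" "ereal d < A" using ereal_dense2 by blast
  then have "A \<le> ereal (c + (d - c))" using c(1) by (intro assms) auto
  with d show False by simp
qed

lemma uniform_modulus:
  fixes \<psi> :: "'a::metric_space \<Rightarrow> real"
  assumes "compact K" "continuous_on K \<psi>" "0 < \<delta>"
  obtains \<eta> where "0 < \<eta>" "\<And>x z. x \<in> K \<Longrightarrow> z \<in> K \<Longrightarrow> dist x z < \<eta> \<Longrightarrow> \<psi> x \<le> \<psi> z + \<delta>"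
proof -
  from compact_uniformly_continuous[OF assms(2,1)] assms(3) obtain \<eta> where
    "0 < \<eta>" "\<forall>x\<in>K. \<forall>z\<in>K. dist z x < \<eta> \<longrightarrow> dist (\<psi> z) (\<psi> x) < \<delta>"
    unfolding uniformly_continuous_on_def by blast
  then show thesis
    by (intro that[of \<eta>]) (force simp: dist_real_def)+
qed

lemma continuous_on_compact_lower_bound:
  fixes \<psi> :: "'a::metric_space \<Rightarrow> real"
  assumes "compact K" "continuous_on K \<psi>"
  obtains B where "\<And>x. x \<in> K \<Longrightarrow> - B \<le> \<psi> x"
proof -
  have "bounded (\<psi> ` K)"
    using assms by (intro compact_imp_bounded compact_continuous_image)
  then obtain B where "\<forall>x\<in>K. \<bar>\<psi> x\<bar> \<le> B" by (auto simp: bounded_iff)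
  then show thesis by (intro that[of B]) fastforce
qed

text \<open>Only the existence of some \<open>R\<close> counts: it is the crude one-step bound with
  which the renewal argument starts. The neighbourhoods are left abstract because in the skew
  product they are cylinders times balls.\<close>

lemma bowen_cover_1_compact:
  fixes K :: "'b::metric_space set"
  assumes "compact K"
    and "\<And>z. z \<in> K \<Longrightarrow> open (W z) \<and> z \<in> W z"
    and "\<And>x z. x \<in> K \<Longrightarrow> z \<in> K \<Longrightarrow> x \<in> W z \<Longrightarrow> V x z"
    and "\<And>x y z. V x z \<Longrightarrow> V y z \<Longrightarrow> U x y"
    and "\<And>x z. V x z \<Longrightarrow> \<psi> x \<le> \<psi> z + \<delta>"
  obtains R where "bowen_cover T \<psi> U 1 K R"
proof -
  obtain E where E: "E \<subseteq> K" "finite E" "K \<subseteq> (\<Union>z\<in>E. W z)"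
    by (rule compactE_image[OF assms(1), of K W]) (use assms(2) in auto)
  have "K \<subseteq> (\<Union>e\<in>E. {x. \<forall>i<1. V ((T ^^ i) x) ((T ^^ i) e)})"
    using E assms(3) by fastforce
  moreover have "bowen_cover T \<psi> U 1 (\<Union>e\<in>E. {x. \<forall>i<1. V ((T ^^ i) x) ((T ^^ i) e)})
      (exp (\<delta> * real 1) * (\<Sum>e\<in>E. exp (birkhoff_sum T \<psi> 1 e)))"
    using E(2) assms(4,5) by (rule bowen_cover_balls)
  ultimately show thesis by (intro that) (rule bowen_cover_mono[OF _ _ order_refl])
qed

section \<open>The two inequalities between a system and an extension\<close>

text \<open>A spanning set upstairs, of one fixed length \<open>N\<close>, projects to centres that
  serve the core. Strict closeness at finitely many times is an open condition, so the same centres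
  serve a neighbourhood of it and hence some image \<open>S\<close> of \<open>K\<close> under
  \<open>T ^^ q\<close>. As \<open>S\<close> is invariant, this one block can be repeated forever;
  the \<open>q\<close> steps before \<open>S\<close> is reached cost a constant.\<close>

theorem topological_pressure_le_extension:
  fixes K :: "'b::metric_space set" and K' :: "'c::metric_space set"
  assumes K: "compact K" "continuous_on K T" "T ` K \<subseteq> K" "continuous_on K \<psi>"
    and maps: "\<And>u. u \<in> K' \<Longrightarrow> T' u \<in> K'" and semi: "\<And>u. u \<in> K' \<Longrightarrow> p (T' u) = T (p u)"
    and into: "\<And>u. u \<in> K' \<Longrightarrow> p u \<in> K"
    and core: "(\<Inter>n. (T ^^ n) ` K) \<subseteq> p ` K'"
    and unif: "\<And>\<epsilon>. 0 < \<epsilon> \<Longrightarrow> \<exists>\<delta>>0. \<forall>u v. dist u v \<le> \<delta> \<longrightarrow> dist (p u) (p v) < \<epsilon>"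
  shows "topological_pressure K T \<psi> \<le> topological_pressure K' T' (\<psi> \<circ> p)"
proof (rule ereal_le_if_le_add_real)
  fix c \<delta> :: real
  assume c: "topological_pressure K' T' (\<psi> \<circ> p) < ereal c" and \<delta>: "0 < \<delta>"
  show "topological_pressure K T \<psi> \<le> ereal (c + \<delta>)"
  proof (rule topological_pressure_leI)
    fix \<epsilon> :: real assume \<epsilon>: "0 < \<epsilon>"
    obtain \<eta> where \<eta>: "0 < \<eta>" "\<And>x z. x \<in> K \<Longrightarrow> z \<in> K \<Longrightarrow> dist x z < \<eta> \<Longrightarrow> \<psi> x \<le> \<psi> z + \<delta>"
      using uniform_modulus[OF K(1,4) \<delta>] by blast
    define e where "e = min \<eta> (\<epsilon> / 2)"
    have e: "0 < e" "e \<le> \<eta>" "e \<le> \<epsilon> / 2" using \<eta>(1) \<epsilon> by (auto simp: e_def)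
    \<comment> \<open>The inequality is strict so that the sets following a centre are open in
      \<open>K\<close>.\<close>
    define V where "V = (\<lambda>x z. x \<in> K \<and> z \<in> K \<and> dist x z < e)"
    define U where "U = (\<lambda>x y :: 'b. dist x y \<le> \<epsilon>)"
    have VU: "U x y" if "V x z" "V y z" for x y z
    proof -
      have "dist x y \<le> dist x z + dist y z" by (rule dist_triangle2)
      with that e(3) show ?thesis by (simp add: V_def U_def)
    qed
    have V\<psi>: "\<psi> x \<le> \<psi> z + \<delta>" if "V x z" for x z
      using that \<eta>(2)[of x z] e(2) by (auto simp: V_def)
    obtain e' where e': "0 < e'" "\<And>u v. dist u v \<le> e' \<Longrightarrow> dist (p u) (p v) < e"
      using unif[OF e(1)] by blast
    from eventually_happens'[OF sequentially_bot
        eventually_conj[OF eventually_spanning_if_topological_pressure_less[OF c e'(1)] eventually_gt_at_top[of 0]]]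
    obtain N E where N: "0 < N" and E: "finite E" "spanning K' T' N e' E"
      "(\<Sum>u\<in>E. exp (birkhoff_sum T' (\<psi> \<circ> p) N u)) < exp (c * real N)"
      by blast
    have EK: "E \<subseteq> K'" using E(2) by (simp add: spanning_def)
    have sc: "p ((T' ^^ i) u) = (T ^^ i) (p u)" if "u \<in> K'" for u i
      using that maps semi by (intro funpow_semiconj(2)[of K' T' p T])
    have "(\<Sum>x\<in>p ` E. exp (birkhoff_sum T \<psi> N x)) \<le> (\<Sum>u\<in>E. exp (birkhoff_sum T \<psi> N (p u)))"
      using sum_image_le[OF E(1), of "\<lambda>x. exp (birkhoff_sum T \<psi> N x)" p] by (simp add: comp_def)
    also have "\<dots> = (\<Sum>u\<in>E. exp (birkhoff_sum T' (\<psi> \<circ> p) N u))"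
      using EK birkhoff_sum_semiconj[of K' T' p T, OF maps semi] by (intro sum.cong) auto
    finally have wE: "(\<Sum>x\<in>p ` E. exp (birkhoff_sum T \<psi> N x)) \<le> exp (c * real N)" using E(3) by linarith
    define W where "W = (\<Union>x\<in>p ` E. {y. \<forall>i<N. V ((T ^^ i) y) ((T ^^ i) x)})"
    have covW: "bowen_cover T \<psi> U N W (exp ((c + \<delta>) * real N))"
      unfolding W_def
      by (rule bowen_cover_mono[OF bowen_cover_balls[of "p ` E" V U \<psi> \<delta>, OF _ VU V\<psi>]])
        (use E(1) wE in \<open>auto simp: distrib_right exp_add\<close>)
    have orbK: "(T ^^ i) x \<in> K" if "x \<in> K" for i x
      using that funpow_image_subset[OF K(3)] by blast
    \<comment> \<open>Preimages of balls make relative openness visible; \<open>0 < N\<close> yields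
      membership in \<open>K\<close> from time 0.\<close>
    have W_eq: "W = (\<Union>x\<in>p ` E. (\<Inter>i<N. K \<inter> (T ^^ i) -` ball ((T ^^ i) x) e) \<inter> K)" (is "_ = ?W")
    proof -
      have "(\<forall>i<N. V ((T ^^ i) y) ((T ^^ i) x)) \<longleftrightarrow>
          y \<in> (\<Inter>i<N. K \<inter> (T ^^ i) -` ball ((T ^^ i) x) e) \<inter> K" if "x \<in> p ` E" for x y
      proof -
        have "x \<in> K" using that EK into by auto
        then show ?thesis
          using N orbK by (auto simp: V_def dist_commute dest: spec[of _ 0])
      qed
      then show ?thesis unfolding W_def by blast
    qed
    have "openin (top_of_set K) ?W"
    proof (rule openin_Union, clarify)
      fix u assume "u \<in> E"
      have "openin (top_of_set K) ((\<Inter>i<N. K \<inter> (T ^^ i) -` ball ((T ^^ i) (p u)) e) \<inter> topspace (top_of_set K))"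
        by (intro openin_INT) (auto intro!: continuous_openin_preimage_gen continuous_on_funpow K)
      then show "openin (top_of_set K) ((\<Inter>i<N. K \<inter> (T ^^ i) -` ball ((T ^^ i) (p u)) e) \<inter> K)"
        by simp
    qed
    then obtain O' where O': "open O'" "W = K \<inter> O'"
      unfolding W_eq[symmetric] openin_open by blast
    have "(\<Inter>n. (T ^^ n) ` K) \<subseteq> W"
    proof
      fix x assume "x \<in> (\<Inter>n. (T ^^ n) ` K)"
      with core obtain u where u: "u \<in> K'" "x = p u" by blast
      with E(2) obtain v where v: "v \<in> E" "\<forall>i<N. dist ((T' ^^ i) u) ((T' ^^ i) v) \<le> e'"
        unfolding spanning_def by blast
      have "V ((T ^^ i) x) ((T ^^ i) (p v))" if "i < N" for i
      proof -
        have vK: "v \<in> K'" using v(1) EK by blast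
        have "dist (p ((T' ^^ i) u)) (p ((T' ^^ i) v)) < e" using v(2) that by (intro e'(2)) blast
        then show ?thesis
          using sc[OF u(1)] sc[OF vK] u(2) orbK into u(1) vK by (simp add: V_def)
      qed
      then show "x \<in> W" using v(1) unfolding W_def by blast
    qed
    then have "\<exists>n. (T ^^ n) ` K \<subseteq> O'"
      using O' K by (intro decreasing_compacts_subset_open decseq_funpow_image compact_continuous_image continuous_on_funpow) auto
    then obtain q where q: "(T ^^ q) ` K \<subseteq> O'" ..
    define S where "S = (T ^^ q) ` K"
    have SK: "S \<subseteq> K" unfolding S_def by (rule funpow_image_subset[OF K(3)])
    have "T ((T ^^ q) x) = (T ^^ q) (T x)" for x by (simp add: funpow_swap1)
    then have SI: "T ` S \<subseteq> S" using K(3) by (auto simp: S_def)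
    obtain R0 where R0: "bowen_cover T \<psi> U 1 K R0"
      by (rule bowen_cover_1_compact[of K "\<lambda>z. ball z e" V U \<psi> \<delta> T])
        (use K(1) e(1) VU V\<psi> in \<open>auto simp: V_def dist_commute\<close>)
    \<comment> \<open>A single block of length \<open>N\<close> covers all of \<open>S\<close>, and
      its weight discounted at rate \<open>c + \<delta>\<close> is exactly 1.\<close>
    have "\<exists>B. \<forall>n. bowen_cover T \<psi> U n S (B * exp ((c + \<delta>) * real n))"
    proof (rule bowen_cover_renewal[where I = "{()}" and D = "\<lambda>_. S" and l = "\<lambda>_. N" and
          R = "\<lambda>_. exp ((c + \<delta>) * real N)"])
      show "bowen_cover T \<psi> U 1 S R0" using R0 SK by (blast intro: bowen_cover_mono)
      have "S \<subseteq> W" using q SK O' by (auto simp: S_def)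
      then show "bowen_cover T \<psi> U N S (exp ((c + \<delta>) * real N))"
        using covW by (blast intro: bowen_cover_mono)
    qed (use SI N in \<open>auto simp: algebra_simps simp flip: exp_add\<close>)
    then obtain B where B: "\<And>n. bowen_cover T \<psi> U n S (B * exp ((c + \<delta>) * real n))" by blast
    obtain b where b: "\<And>x. x \<in> K \<Longrightarrow> - b \<le> \<psi> x"
      using continuous_on_compact_lower_bound[OF K(1,4)] by blast
    \<comment> \<open>\<open>R0 ^ q\<close> pays for the steps before \<open>S\<close> is reached,
      and the last exponential corrects the length \<open>n - q\<close> to \<open>n\<close>.\<close>
    define D where "D = R0 ^ q * (B * exp (- (c + \<delta>) * real q))"
    have "spanning_weight K T \<psi> n \<epsilon> \<le> ennreal (D * exp ((c + \<delta>) * real n))" if "q \<le> n" for n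
    proof -
      have "bowen_cover T \<psi> U (q + (n - q)) K (R0 ^ q * (B * exp ((c + \<delta>) * real (n - q))))"
        by (rule bowen_cover_concat[OF bowen_cover_power[OF R0 K(3)] B]) (simp add: S_def)
      moreover have "R0 ^ q * (B * exp ((c + \<delta>) * real (n - q))) = D * exp ((c + \<delta>) * real n)"
        using that by (simp add: D_def of_nat_diff algebra_simps flip: exp_add)
      ultimately have "bowen_cover T \<psi> U (n + 0) K (D * exp ((c + \<delta>) * real n))"
        using that by simp
      \<comment> \<open>Here \<open>T\<close> is compared with itself: the projection is the
        identity and \<open>k = l = 0\<close>.\<close>
      from spanning_weight_le_bowen_cover[OF this K(3), of K T id 0 \<epsilon> b] b K(3)
      show ?thesis by (auto simp: U_def)
    qed
    then show "\<exists>D. \<forall>\<^sub>F n in sequentially. spanning_weight K T \<psi> n \<epsilon> \<le> ennreal (D * exp ((c + \<delta>) * real n))"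
      by (intro exI[of _ D] eventually_sequentiallyI[of q])
  qed
qed

text \<open>The delay \<open>k\<close> and the horizon \<open>l\<close> in \<open>gen\<close> depend
  on \<epsilon> but not on \<open>n\<close>. Lengthening base covers by \<open>l\<close> thus
  changes weights by a bounded factor, which the growth rate does not see.\<close>

theorem topological_pressure_extension_le:
  fixes K :: "'b::metric_space set" and K' :: "'c::metric_space set"
  assumes K: "compact K" "T ` K \<subseteq> K" "continuous_on K \<psi>"
    and maps: "\<And>u. u \<in> K' \<Longrightarrow> T' u \<in> K'" and semi: "\<And>u. u \<in> K' \<Longrightarrow> p (T' u) = T (p u)"
    and into: "\<And>u. u \<in> K' \<Longrightarrow> p u \<in> K" and onto: "K' \<subseteq> T' ` K'"
    and gen: "\<And>\<epsilon>. 0 < \<epsilon> \<Longrightarrow> \<exists>k l \<eta>. k \<le> l \<and> 0 < \<eta> \<and> (\<forall>u\<in>K'. \<forall>v\<in>K'.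
        (\<forall>j\<le>l. dist ((T ^^ j) (p u)) ((T ^^ j) (p v)) \<le> \<eta>) \<longrightarrow> dist ((T' ^^ k) u) ((T' ^^ k) v) \<le> \<epsilon>)"
  shows "topological_pressure K' T' (\<psi> \<circ> p) \<le> topological_pressure K T \<psi>"
proof (rule ereal_le_if_le_add_real)
  fix c \<delta> :: real
  assume c: "topological_pressure K T \<psi> < ereal c" and \<delta>: "0 < \<delta>"
  show "topological_pressure K' T' (\<psi> \<circ> p) \<le> ereal (c + \<delta>)"
  proof (rule topological_pressure_leI)
    fix \<epsilon> :: real assume "0 < \<epsilon>"
    then obtain k l \<eta> where kl: "k \<le> l" and \<eta>: "0 < \<eta>" and
      cl: "\<And>u v. u \<in> K' \<Longrightarrow> v \<in> K' \<Longrightarrow> (\<And>j. j \<le> l \<Longrightarrow> dist ((T ^^ j) (p u)) ((T ^^ j) (p v)) \<le> \<eta>)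
         \<Longrightarrow> dist ((T' ^^ k) u) ((T' ^^ k) v) \<le> \<epsilon>"
      using gen by metis
    obtain \<eta>' where \<eta>': "0 < \<eta>'" "\<And>x z. x \<in> K \<Longrightarrow> z \<in> K \<Longrightarrow> dist x z < \<eta>' \<Longrightarrow> \<psi> x \<le> \<psi> z + \<delta>"
      using uniform_modulus[OF K(1,3) \<delta>] by blast
    \<comment> \<open>Half of \<eta>' turns the weak inequality of spanning sets into the strict one
      of the modulus; half of \<eta> allows for the passage through a centre.\<close>
    define e where "e = min (\<eta>' / 2) (\<eta> / 2)"
    have e: "0 < e" "e < \<eta>'" "e \<le> \<eta> / 2" using \<eta> \<eta>'(1) by (auto simp: e_def)
    define V where "V = (\<lambda>x z. x \<in> K \<and> z \<in> K \<and> dist x z \<le> e)"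
    define U where "U = (\<lambda>x y :: 'b. dist x y \<le> \<eta>)"
    have VU: "U x y" if "V x z" "V y z" for x y z
    proof -
      have "dist x y \<le> dist x z + dist y z" by (rule dist_triangle2)
      with that e(3) show ?thesis by (simp add: V_def U_def)
    qed
    have V\<psi>: "\<psi> x \<le> \<psi> z + \<delta>" if "V x z" for x z
      using that \<eta>'(2)[of x z] e(2) by (auto simp: V_def)
    have onto': "K' \<subseteq> (T' ^^ i) ` K'" for i
    proof (induction i)
      case (Suc i)
      from onto have "K' \<subseteq> T' ` K'" .
      also have "\<dots> \<subseteq> T' ` ((T' ^^ i) ` K')" by (rule image_mono[OF Suc])
      finally show ?case by (simp add: image_comp)
    qed simp
    obtain b where b: "\<And>x. x \<in> K \<Longrightarrow> - b \<le> \<psi> x"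
      using continuous_on_compact_lower_bound[OF K(1,3)] by blast
    have "\<forall>\<^sub>F n in sequentially. bowen_cover T \<psi> U n K (exp ((c + \<delta>) * real n))"
      using eventually_spanning_if_topological_pressure_less[OF c e(1)]
    proof eventually_elim
      case (elim n)
      then obtain E where E: "finite E" "spanning K T n e E"
        "(\<Sum>x\<in>E. exp (birkhoff_sum T \<psi> n x)) < exp (c * real n)" by blast
      have "K \<subseteq> (\<Union>x\<in>E. {y. \<forall>i<n. V ((T ^^ i) y) ((T ^^ i) x)})"
      proof
        fix y assume y: "y \<in> K"
        with E(2) obtain x where x: "x \<in> E" "\<forall>i<n. dist ((T ^^ i) y) ((T ^^ i) x) \<le> e" "x \<in> K"
          unfolding spanning_def by blast
        then have "V ((T ^^ i) y) ((T ^^ i) x)" if "i < n" for i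
          using that y funpow_image_subset[OF K(2), of i] by (auto simp: V_def)
        with x(1) show "y \<in> (\<Union>x\<in>E. {y. \<forall>i<n. V ((T ^^ i) y) ((T ^^ i) x)})" by blast
      qed
      moreover have "bowen_cover T \<psi> U n (\<Union>x\<in>E. {y. \<forall>i<n. V ((T ^^ i) y) ((T ^^ i) x)})
          (exp (\<delta> * real n) * (\<Sum>x\<in>E. exp (birkhoff_sum T \<psi> n x)))"
        using E(1) VU V\<psi> by (rule bowen_cover_balls)
      moreover have "exp (\<delta> * real n) * (\<Sum>x\<in>E. exp (birkhoff_sum T \<psi> n x)) \<le> exp ((c + \<delta>) * real n)"
        using E(3) by (simp add: distrib_right exp_add)
      ultimately show ?case
        by (elim bowen_cover_mono[rotated])
    qed
    \<comment> \<open>Covers are needed at length \<open>n + l\<close>; the surplus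
      \<open>exp ((c + \<delta>) * l)\<close> joins the constant.\<close>
    then have "\<forall>\<^sub>F n in sequentially. bowen_cover T \<psi> U (n + l) K (exp ((c + \<delta>) * real (n + l)))"
      by (subst eventually_sequentially_seg)
    then have "\<forall>\<^sub>F n in sequentially. spanning_weight K' T' (\<psi> \<circ> p) n \<epsilon>
        \<le> ennreal ((exp ((c + \<delta>) * real l) * exp (b * real l)) * exp ((c + \<delta>) * real n))"
    proof eventually_elim
      case (elim n)
      have "spanning_weight K' T' (\<psi> \<circ> p) n \<epsilon> \<le> ennreal (exp ((c + \<delta>) * real (n + l)) * exp (b * real l))"
        using elim K(2) maps semi into onto'[of k] kl
        by (rule spanning_weight_le_bowen_cover) (use cl b in \<open>auto simp: U_def\<close>)
      then show ?case by (simp add: distrib_left exp_add ac_simps)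
    qed
    then show "\<exists>D. \<forall>\<^sub>F n in sequentially. spanning_weight K' T' (\<psi> \<circ> p) n \<epsilon>
        \<le> ennreal (D * exp ((c + \<delta>) * real n))" ..
  qed
qed

section \<open>The metric on function spaces\<close>

lemma dist_component_le:
  fixes u v :: "'i::countable \<Rightarrow> 'b::metric_space"
  shows "(1/2) ^ to_nat i * min (dist (u i) (v i)) 1 \<le> dist u v"
proof -
  have "summable (\<lambda>n. (1/2) ^ n * min (dist (u (from_nat n)) (v (from_nat n))) 1)"
    by (rule summable_comparison_test'[of "\<lambda>n. (1/2) ^ n"]) (auto simp: summable_geometric_iff)
  from sum_le_suminf[OF this, of "{to_nat i}"] show ?thesis
    by (simp add: dist_fun_def)
qed

lemma uniform_component:
  fixes i :: "'i::countable"
  assumes "0 < \<epsilon>"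
  obtains \<delta> where "0 < \<delta>"
    "\<And>u v :: 'i \<Rightarrow> 'b::metric_space. dist u v \<le> \<delta> \<Longrightarrow> dist (u i) (v i) < \<epsilon>"
proof
  \<comment> \<open>Being below 1, the bound \<open>min \<epsilon> 1 / 2\<close> rules out that the
    truncated distance is the truncation value; the half makes the conclusion strict.\<close>
  define \<delta> :: real where "\<delta> = (1/2) ^ to_nat i * (min \<epsilon> 1 / 2)"
  show "0 < \<delta>" using assms by (simp add: \<delta>_def)
  fix u v :: "'i \<Rightarrow> 'b" assume "dist u v \<le> \<delta>"
  then have "(1/2) ^ to_nat i * min (dist (u i) (v i)) 1 \<le> (1/2) ^ to_nat i * (min \<epsilon> 1 / 2)"
    using dist_component_le[of i u v] unfolding \<delta>_def by linarith
  then have "min (dist (u i) (v i)) 1 \<le> min \<epsilon> 1 / 2"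
    by (rule mult_left_le_imp_le) simp
  then show "dist (u i) (v i) < \<epsilon>" using assms by (simp add: min_def split: if_splits)
qed

lemma uniform_components:
  fixes J :: "'i::countable set"
  assumes "finite J" "0 < \<epsilon>"
  obtains \<delta> where "0 < \<delta>"
    "\<And>u v :: 'i \<Rightarrow> 'b::metric_space. \<And>j. dist u v \<le> \<delta> \<Longrightarrow> j \<in> J \<Longrightarrow> dist (u j) (v j) < \<epsilon>"
proof -
  have "\<exists>\<delta>>0. \<forall>u v :: 'i \<Rightarrow> 'b. dist u v \<le> \<delta> \<longrightarrow> (\<forall>j\<in>J. dist (u j) (v j) < \<epsilon>)"
    using assms(1)
  proof (induction J rule: finite_induct)
    case (insert i J)
    then obtain \<delta> where \<delta>: "0 < \<delta>" "\<And>u v :: 'i \<Rightarrow> 'b. dist u v \<le> \<delta> \<Longrightarrow> \<forall>j\<in>J. dist (u j) (v j) < \<epsilon>"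
      by blast
    obtain \<delta>' where \<delta>': "0 < \<delta>'" "\<And>u v :: 'i \<Rightarrow> 'b. dist u v \<le> \<delta>' \<Longrightarrow> dist (u i) (v i) < \<epsilon>"
      using uniform_component[OF assms(2)] by blast
    show ?case
      using \<delta> \<delta>' by (intro exI[of _ "min \<delta> \<delta>'"]) auto
  qed (auto intro: exI[of _ 1])
  then show thesis using that by blast
qed

lemma dist_fun_le_if_finitely_many_components:
  assumes "0 < \<epsilon>"
  obtains J :: "'i::countable set" and \<eta> where "finite J" "0 < \<eta>"
    "\<And>u v :: 'i \<Rightarrow> 'b::metric_space. (\<And>j. j \<in> J \<Longrightarrow> dist (u j) (v j) \<le> \<eta>) \<Longrightarrow> dist u v \<le> \<epsilon>"
proof -
  obtain N where N: "(1/2::real) ^ N < \<epsilon> / 2"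
    using real_arch_pow_inv[of "\<epsilon> / 2" "1/2"] assms by auto
  \<comment> \<open>The metric is at most twice the largest distance over the enumerated coordinates
    up to \<open>N\<close>, plus \<open>(1/2) ^ N\<close>; hence \<epsilon>/4 for the former and
    \<epsilon>/2 for the latter.\<close>
  show thesis
  proof (rule that[of "from_nat ` {..N}" "\<epsilon> / 4"])
    fix u v :: "'i \<Rightarrow> 'b" assume *: "\<And>j. j \<in> from_nat ` {..N} \<Longrightarrow> dist (u j) (v j) \<le> \<epsilon> / 4"
    have "Max {dist (u (from_nat n)) (v (from_nat n)) | n. n \<le> N} \<le> \<epsilon> / 4"
      by (rule Max.boundedI) (use * in auto)
    with dist_fun_le_dist_first_terms[of u v N] N show "dist u v \<le> \<epsilon>" by linarith
  qed (use assms in auto)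
qed

lemma dist_prod_le: "dist p q \<le> dist (fst p) (fst q) + dist (snd p) (snd q)"
  by (simp add: dist_prod_def sqrt_sum_squares_le_sum)

section \<open>The skew product\<close>

lemma compact_one_sided: "compact (one_sided m)"
proof -
  have "one_sided m = (\<Pi>\<^sub>E i\<in>UNIV. {1..m})" by (auto simp: one_sided_def PiE_UNIV_domain)
  moreover have "compactin (product_topology (\<lambda>_. euclidean) UNIV) (\<Pi>\<^sub>E i\<in>(UNIV :: nat set). {1..m})"
    by (simp add: compactin_PiE finite_imp_compact)
  ultimately show ?thesis
    unfolding euclidean_product_topology by simp
qed

text \<open>The first symbol is locally constant: it cuts the product into finitely many closed
  pieces, on each of which a single \<open>g j\<close> acts.\<close>

lemma continuous_on_fibrewise:
  fixes g :: "nat \<Rightarrow> 'a::metric_space \<Rightarrow> 'c::topological_space"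
  assumes "compact X" "\<And>j. j \<in> {1..m} \<Longrightarrow> continuous_on X (g j)"
  shows "continuous_on (one_sided m \<times> X) (\<lambda>(\<omega>, x). g (\<omega> 0) x)"
proof -
  define Z where "Z = (\<lambda>j. (one_sided m \<inter> (\<lambda>\<omega>. \<omega> 0) -` {j}) \<times> X)"
  have "one_sided m \<times> X = (\<Union>j\<in>{1..m}. Z j)" by (auto simp: Z_def one_sided_def)
  moreover have "continuous_on (\<Union>j\<in>{1..m}. Z j) (\<lambda>(\<omega>, x). g (\<omega> 0) x)"
  proof (rule continuous_on_closed_Union)
    fix j assume j: "j \<in> {1..m}"
    have "closed ((\<lambda>\<omega>. \<omega> 0) -` {j} :: (nat \<Rightarrow> nat) set)"
      by (intro closed_vimage continuous_on_product_coordinates) simp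
    then show "closed (Z j)"
      unfolding Z_def using assms(1) compact_one_sided
      by (intro closed_Times closed_Int compact_imp_closed) auto
    have "continuous_on (Z j) (\<lambda>p. g j (snd p))"
      by (rule continuous_on_compose2[OF assms(2)[OF j]]) (auto simp: Z_def intro: continuous_intros)
    then show "continuous_on (Z j) (\<lambda>(\<omega>, x). g (\<omega> 0) x)"
      by (rule continuous_on_eq) (auto simp: Z_def)
  qed simp
  ultimately show ?thesis by simp
qed

lemma continuous_on_skew_product:
  fixes f :: "nat \<Rightarrow> 'a::metric_space \<Rightarrow> 'a"
  assumes "compact X" "\<And>j. j \<in> {1..m} \<Longrightarrow> continuous_on X (f j)"
  shows "continuous_on (one_sided m \<times> X) (skew_product f)"
proof -
  have "continuous_on (one_sided m \<times> X) (\<lambda>p. (\<lambda>i. fst p (i + 1)))"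
  proof (rule continuous_on_coordinatewise_then_product)
    show "continuous_on (one_sided m \<times> X) (\<lambda>p. fst p (i + 1))" for i
      by (rule continuous_on_product_then_coordinatewise) (rule continuous_on_fst[OF continuous_on_id])
  qed
  then have "continuous_on (one_sided m \<times> X) (\<lambda>p. (\<lambda>i. fst p (i + 1), (\<lambda>(\<omega>, x). f (\<omega> 0) x) p))"
    by (rule continuous_on_Pair) (rule continuous_on_fibrewise[OF assms])
  then show ?thesis by (rule continuous_on_eq) (auto simp: skew_product_def)
qed

lemma skew_product_image_subset:
  assumes "\<And>j. j \<in> {1..m} \<Longrightarrow> f j \<in> X \<rightarrow> X"
  shows "skew_product f ` (one_sided m \<times> X) \<subseteq> one_sided m \<times> X"
proof -
  have "f (\<omega> 0) x \<in> X" if "\<forall>i. \<omega> i \<in> {1..m}" "x \<in> X" for \<omega> x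
    using that assms[of "\<omega> 0"] by auto
  then show ?thesis by (auto simp: skew_product_def one_sided_def)
qed

lemma funpow_skew_product:
  "(skew_product f ^^ n) (\<omega>, x) = (\<lambda>i. \<omega> (i + n), word_map f (rev (seq_prefix n \<omega>)) x)"
  by (induction n) (auto simp: seq_prefix_def word_map_def skew_product_def)

lemma take_seq_prefix: "k \<le> n \<Longrightarrow> take k (seq_prefix n \<omega>) = seq_prefix k \<omega>"
  by (simp add: seq_prefix_def take_map)

lemma word_sum_seq_prefix:
  "word_sum f \<phi> x (seq_prefix n \<omega>) = birkhoff_sum (skew_product f) (skew_potential \<phi>) n (\<omega>, x)"
  unfolding word_sum_def birkhoff_sum_def
  by (intro sum.cong)
    (auto simp: funpow_skew_product skew_potential_def take_seq_prefix less_imp_le, auto simp: seq_prefix_def)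

section \<open>The inverse limit\<close>

text \<open>The preimages of \<open>y\<close> inside the \<open>n\<close>-th image of
  \<open>K\<close> form a decreasing sequence of compact sets. If they had no common point, one of
  them would be empty, although \<open>y\<close> lies in the image of index
  \<open>Suc n\<close>.\<close>

lemma backward_step_in_core:
  fixes K :: "'b::metric_space set"
  assumes "compact K" "continuous_on K T" "T ` K \<subseteq> K" "y \<in> (\<Inter>n. (T ^^ n) ` K)"
  shows "\<exists>z\<in>(\<Inter>n. (T ^^ n) ` K). T z = y"
proof (rule ccontr)
  assume no: "\<not> ?thesis"
  have sub: "(T ^^ n) ` K \<subseteq> K" for n by (rule funpow_image_subset[OF assms(3)])
  have "\<exists>n. (T ^^ n) ` K \<inter> (K \<inter> T -` {y}) \<subseteq> {}"
  proof (rule decreasing_compacts_subset_open)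
    show "compact ((T ^^ n) ` K \<inter> (K \<inter> T -` {y}))" for n
    proof (rule compact_Int_closed)
      show "compact ((T ^^ n) ` K)"
        by (intro compact_continuous_image continuous_on_funpow assms)
      show "closed (K \<inter> T -` {y})"
        using assms(1,2) by (intro continuous_closed_preimage compact_imp_closed) auto
    qed
    show "decseq (\<lambda>n. (T ^^ n) ` K \<inter> (K \<inter> T -` {y}))"
      using decseq_funpow_image[OF assms(3)] by (fastforce simp: decseq_def)
    show "(\<Inter>n. (T ^^ n) ` K \<inter> (K \<inter> T -` {y})) \<subseteq> {}"
      using no by blast
  qed simp
  then obtain n where n: "(T ^^ n) ` K \<inter> (K \<inter> T -` {y}) = {}" by blast
  from assms(4) obtain x where "x \<in> K" "y = (T ^^ Suc n) x" by blast
  then have "(T ^^ n) x \<in> (T ^^ n) ` K \<inter> (K \<inter> T -` {y})" using sub by auto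
  with n show False by blast
qed

text \<open>The past is built from preimages chosen inside the core, where every point has another
  one, so the choice never gets stuck.\<close>

lemma two_sided_orbit:
  fixes K :: "'b::metric_space set"
  assumes "compact K" "continuous_on K T" "T ` K \<subseteq> K" "y \<in> (\<Inter>n. (T ^^ n) ` K)"
  obtains w :: "int \<Rightarrow> 'b" where "w 0 = y" "\<And>j. w j \<in> K" "\<And>j. w (j + 1) = T (w j)"
proof -
  define C where "C = (\<Inter>n. (T ^^ n) ` K)"
  define b where "b = (\<lambda>y. SOME z. z \<in> C \<and> T z = y)"
  have b: "b z \<in> C" "T (b z) = z" if "z \<in> C" for z
    using someI_ex[of "\<lambda>x. x \<in> C \<and> T x = z"] backward_step_in_core[OF assms(1-3), of z] that
    unfolding b_def C_def by blast+
  have "C \<subseteq> (T ^^ 0) ` K" unfolding C_def by blast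
  then have CK: "C \<subseteq> K" by simp
  have bC: "(b ^^ n) y \<in> C" for n
    using assms(4) b(1) by (induction n) (auto simp: C_def[symmetric])
  define w where "w = (\<lambda>j :: int. if 0 \<le> j then (T ^^ nat j) y else (b ^^ nat (- j)) y)"
  show thesis
  proof (rule that[of w])
    show "w 0 = y" by (simp add: w_def)
    show "w j \<in> K" for j
      using CK bC funpow_image_subset[OF assms(3), of "nat j"] assms(4)
      by (auto simp: w_def C_def[symmetric])
    show "w (j + 1) = T (w j)" for j
    proof (cases "0 \<le> j")
      case True
      then have "nat (j + 1) = Suc (nat j)" by simp
      with True show ?thesis by (simp add: w_def)
    next
      case False
      then have "nat (- j) = Suc (nat (- (j + 1)))" by simp
      then have "w j = b ((b ^^ nat (- (j + 1))) y)" using False by (simp add: w_def)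
      then have "T (w j) = (b ^^ nat (- (j + 1))) y" using b(2)[OF bC] by simp
      \<comment> \<open>At \<open>j = -1\<close> the two halves of the definition meet, and both
        give \<open>y\<close> at time 0.\<close>
      also have "\<dots> = w (j + 1)" using False by (cases "j = -1") (auto simp: w_def)
      finally show ?thesis ..
    qed
  qed
qed

section \<open>Projection of the inverse limit to the skew product\<close>

definition inverse_limit_proj :: "(int \<Rightarrow> nat) \<times> (int \<Rightarrow> 'a) \<Rightarrow> (nat \<Rightarrow> nat) \<times> 'a" where
  "inverse_limit_proj = (\<lambda>(\<eta>, x). (\<lambda>i. \<eta> (int i), x 0))"

lemma inverse_limit_potential_eq: "inverse_limit_potential \<phi> = skew_potential \<phi> \<circ> inverse_limit_proj"
  by (auto simp: inverse_limit_potential_def skew_potential_def inverse_limit_proj_def)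

lemma inverse_limit_iff:
  "(\<eta>, x) \<in> inverse_limit m X f \<longleftrightarrow>
    (\<forall>j. \<eta> j \<in> {1..m}) \<and> (\<forall>j. x j \<in> X) \<and> (\<forall>j. f (\<eta> j) (x j) = x (j + 1))"
proof -
  have "(\<forall>j. x j = f (\<eta> (j - 1)) (x (j - 1))) \<longleftrightarrow> (\<forall>j. f (\<eta> j) (x j) = x (j + 1))"
  proof (intro iffI allI)
    fix j assume *: "\<forall>j. x j = f (\<eta> (j - 1)) (x (j - 1))"
    show "f (\<eta> j) (x j) = x (j + 1)" using *[rule_format, of "j + 1"] by simp
  next
    fix j assume *: "\<forall>j. f (\<eta> j) (x j) = x (j + 1)"
    show "x j = f (\<eta> (j - 1)) (x (j - 1))" using *[rule_format, of "j - 1"] by simp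
  qed
  then show ?thesis unfolding inverse_limit_def two_sided_def by blast
qed

lemma inverse_limit_shift_mem:
  "u \<in> inverse_limit m X f \<Longrightarrow> inverse_limit_shift u \<in> inverse_limit m X f"
  by (cases u) (simp add: inverse_limit_shift_def inverse_limit_iff)

lemma inverse_limit_shift_onto:
  "inverse_limit m X f \<subseteq> inverse_limit_shift ` inverse_limit m X f"
proof clarify
  fix \<eta> x assume "(\<eta>, x) \<in> inverse_limit m X f"
  then have "(\<lambda>i. \<eta> (i - 1), \<lambda>i. x (i - 1)) \<in> inverse_limit m X f"
    by (simp add: inverse_limit_iff)
  then show "(\<eta>, x) \<in> inverse_limit_shift ` inverse_limit m X f"
    by (rule rev_image_eqI) (simp add: inverse_limit_shift_def)
qed

lemma inverse_limit_proj_shift: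
  "u \<in> inverse_limit m X f \<Longrightarrow>
    inverse_limit_proj (inverse_limit_shift u) = skew_product f (inverse_limit_proj u)"
  by (cases u) (simp add: inverse_limit_iff inverse_limit_shift_def inverse_limit_proj_def
      skew_product_def add.commute)

lemma inverse_limit_proj_mem: "u \<in> inverse_limit m X f \<Longrightarrow> inverse_limit_proj u \<in> one_sided m \<times> X"
  by (cases u) (simp add: inverse_limit_iff inverse_limit_proj_def one_sided_def)

lemma funpow_inverse_limit_shift:
  "(inverse_limit_shift ^^ n) (\<eta>, x) = (\<lambda>i. \<eta> (i + int n), \<lambda>i. x (i + int n))"
  by (induction n) (auto simp: inverse_limit_shift_def algebra_simps)

text \<open>A two-sided orbit through \<open>y\<close> contains its lift: the first symbols along
  the orbit form \<eta>, the components in \<open>X\<close> form \<open>x\<close>. The one-sided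
  sequences on the orbit are overlapping windows of \<eta>, so projecting returns
  \<open>y\<close>.\<close>

lemma core_subset_inverse_limit_proj:
  fixes X :: "'a::metric_space set"
  assumes "compact X" "\<And>j. j \<in> {1..m} \<Longrightarrow> f j \<in> X \<rightarrow> X" "\<And>j. j \<in> {1..m} \<Longrightarrow> continuous_on X (f j)"
  shows "(\<Inter>n. (skew_product f ^^ n) ` (one_sided m \<times> X)) \<subseteq> inverse_limit_proj ` inverse_limit m X f"
proof
  fix y assume y: "y \<in> (\<Inter>n. (skew_product f ^^ n) ` (one_sided m \<times> X))"
  obtain w :: "int \<Rightarrow> (nat \<Rightarrow> nat) \<times> 'a" where w: "w 0 = y" "\<And>j. w j \<in> one_sided m \<times> X"
      "\<And>j. w (j + 1) = skew_product f (w j)"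
    by (rule two_sided_orbit[OF _ continuous_on_skew_product[OF assms(1,3)] skew_product_image_subset[OF assms(2)] y])
      (auto intro: compact_Times compact_one_sided assms(1))
  define \<eta> where "\<eta> = (\<lambda>j. fst (w j) 0)"
  define x where "x = (\<lambda>j. snd (w j))"
  have fst_w: "fst (w j) i = \<eta> (j + int i)" for i j
  proof (induction i arbitrary: j)
    case (Suc i)
    have "fst (w j) (Suc i) = fst (w (j + 1)) i" by (simp add: w(3) skew_product_def case_prod_beta)
    then show ?case using Suc[of "j + 1"] by (simp add: algebra_simps)
  qed (simp add: \<eta>_def)
  have "f (\<eta> j) (x j) = x (j + 1)" for j
    using w(3)[of j] by (simp add: x_def \<eta>_def skew_product_def case_prod_beta)
  moreover have "\<eta> j \<in> {1..m}" "x j \<in> X" for j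
    using w(2)[of j] by (auto simp: \<eta>_def x_def one_sided_def mem_Times_iff)
  ultimately have "(\<eta>, x) \<in> inverse_limit m X f"
    by (simp add: inverse_limit_iff)
  moreover have "inverse_limit_proj (\<eta>, x) = y"
    using fst_w[of 0] w(1) by (auto simp: inverse_limit_proj_def x_def prod_eq_iff fun_eq_iff)
  ultimately show "y \<in> inverse_limit_proj ` inverse_limit m X f" by force
qed

lemma uniform_inverse_limit_proj:
  assumes "0 < \<epsilon>"
  shows "\<exists>\<delta>>0. \<forall>u v :: (int \<Rightarrow> nat) \<times> (int \<Rightarrow> 'a::metric_space).
    dist u v \<le> \<delta> \<longrightarrow> dist (inverse_limit_proj u) (inverse_limit_proj v) < \<epsilon>"
proof -
  have e2: "0 < \<epsilon> / 2" using assms by simp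
  obtain J :: "nat set" and \<eta> where J: "finite J" "0 < \<eta>"
    "\<And>u v :: nat \<Rightarrow> nat. (\<And>j. j \<in> J \<Longrightarrow> dist (u j) (v j) \<le> \<eta>) \<Longrightarrow> dist u v \<le> \<epsilon> / 2"
    using dist_fun_le_if_finitely_many_components[OF e2, where ?'i = nat and ?'b = nat] by blast
  obtain d where d: "0 < d"
    "\<And>(u :: int \<Rightarrow> nat) v j. dist u v \<le> d \<Longrightarrow> j \<in> int ` J \<Longrightarrow> dist (u j) (v j) < \<eta>"
    using uniform_components[of "int ` J" \<eta>, where ?'b = nat] J(1,2) by blast
  obtain d' where d': "0 < d'" "\<And>u v :: int \<Rightarrow> 'a. dist u v \<le> d' \<Longrightarrow> dist (u 0) (v 0) < \<epsilon> / 2"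
    using uniform_component[OF e2, of 0, where ?'b = 'a] by blast
  show ?thesis
  proof (intro exI[of _ "min d d'"] conjI allI impI)
    show "0 < min d d'" using d d' by simp
    fix u v :: "(int \<Rightarrow> nat) \<times> (int \<Rightarrow> 'a)" assume "dist u v \<le> min d d'"
    then have *: "dist (fst u) (fst v) \<le> d" "dist (snd u) (snd v) \<le> d'"
      using dist_fst_le[of u v] dist_snd_le[of u v] by auto
    have "dist (inverse_limit_proj u) (inverse_limit_proj v)
        \<le> dist (\<lambda>i. fst u (int i)) (\<lambda>i. fst v (int i)) + dist (snd u 0) (snd v 0)"
      using dist_prod_le[of "inverse_limit_proj u" "inverse_limit_proj v"]
      by (simp add: inverse_limit_proj_def case_prod_beta)
    moreover have "dist (\<lambda>i. fst u (int i)) (\<lambda>i. fst v (int i)) \<le> \<epsilon> / 2"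
      using d(2)[OF *(1)] by (intro J(3)) (auto intro: less_imp_le)
    moreover have "dist (snd u 0) (snd v 0) < \<epsilon> / 2" by (rule d'(2)[OF *(2)])
    ultimately show "dist (inverse_limit_proj u) (inverse_limit_proj v) < \<epsilon>" by linarith
  qed
qed

text \<open>Up to \<epsilon> only coordinates with index between \<open>- k\<close> and
  \<open>k\<close> matter. After \<open>k\<close> shifts these are the original coordinates 0 to
  \<open>2 * k\<close>, which the base orbit displays as first symbols and positions in
  \<open>X\<close>; hence \<open>l = 2 * k\<close>.\<close>

lemma inverse_limit_generator:
  fixes X :: "'a::metric_space set"
  assumes "0 < \<epsilon>"
  shows "\<exists>k l \<eta>. k \<le> l \<and> 0 < \<eta> \<and> (\<forall>u\<in>inverse_limit m X f. \<forall>v\<in>inverse_limit m X f.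
    (\<forall>j\<le>l. dist ((skew_product f ^^ j) (inverse_limit_proj u)) ((skew_product f ^^ j) (inverse_limit_proj v)) \<le> \<eta>)
      \<longrightarrow> dist ((inverse_limit_shift ^^ k) u) ((inverse_limit_shift ^^ k) v) \<le> \<epsilon>)"
proof -
  have e2: "0 < \<epsilon> / 2" using assms by simp
  obtain J :: "int set" and e where J: "finite J" "0 < e"
    "\<And>u v :: int \<Rightarrow> nat. (\<And>j. j \<in> J \<Longrightarrow> dist (u j) (v j) \<le> e) \<Longrightarrow> dist u v \<le> \<epsilon> / 2"
    using dist_fun_le_if_finitely_many_components[OF e2, where ?'i = int and ?'b = nat] by blast
  obtain J' :: "int set" and e' where J': "finite J'" "0 < e'"
    "\<And>u v :: int \<Rightarrow> 'a. (\<And>j. j \<in> J' \<Longrightarrow> dist (u j) (v j) \<le> e') \<Longrightarrow> dist u v \<le> \<epsilon> / 2"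
    using dist_fun_le_if_finitely_many_components[OF e2, where ?'i = int and ?'b = 'a] by blast
  obtain d where d: "0 < d" "\<And>u v :: nat \<Rightarrow> nat. dist u v \<le> d \<Longrightarrow> dist (u 0) (v 0) < e"
    using uniform_component[OF J(2), of 0, where ?'b = nat] by blast
  define k where "k = Max (insert 0 ((\<lambda>j. nat \<bar>j\<bar>) ` (J \<union> J')))"
  have k: "\<bar>j\<bar> \<le> int k" if "j \<in> J \<union> J'" for j
  proof -
    have "nat \<bar>j\<bar> \<le> k" unfolding k_def by (rule Max_ge) (use J(1) J'(1) that in auto)
    then show ?thesis by simp
  qed
  show ?thesis
  proof (rule exI[of _ k], rule exI[of _ "2 * k"], rule exI[of _ "min d e'"], intro conjI ballI impI)
    show "0 < min d e'" using d(1) J'(2) by simp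
    fix u v
    assume u: "u \<in> inverse_limit m X f" and v: "v \<in> inverse_limit m X f"
      and close: "\<forall>j\<le>2 * k. dist ((skew_product f ^^ j) (inverse_limit_proj u))
          ((skew_product f ^^ j) (inverse_limit_proj v)) \<le> min d e'"
    have proj: "(skew_product f ^^ j) (inverse_limit_proj w) = (\<lambda>i. fst w (int i + int j), snd w (int j))"
      if "w \<in> inverse_limit m X f" for w j
    proof -
      have "(skew_product f ^^ j) (inverse_limit_proj w) = inverse_limit_proj ((inverse_limit_shift ^^ j) w)"
        using funpow_semiconj(2)[of "inverse_limit m X f" inverse_limit_shift inverse_limit_proj "skew_product f" w j]
          inverse_limit_shift_mem inverse_limit_proj_shift that by metis
      also have "\<dots> = (\<lambda>i. fst w (int i + int j), snd w (int j))"
        by (cases w) (simp add: funpow_inverse_limit_shift inverse_limit_proj_def)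
      finally show ?thesis .
    qed
    have close': "dist (fst u (int j)) (fst v (int j)) \<le> e \<and> dist (snd u (int j)) (snd v (int j)) \<le> e'"
      if "j \<le> 2 * k" for j
    proof -
      let ?p = "(\<lambda>i. fst u (int i + int j), snd u (int j))" and ?q = "(\<lambda>i. fst v (int i + int j), snd v (int j))"
      have "dist ?p ?q \<le> min d e'"
        using close that unfolding proj[OF u] proj[OF v] by blast
      then have *: "dist (fst ?p) (fst ?q) \<le> d" "dist (snd ?p) (snd ?q) \<le> e'"
        using dist_fst_le[of ?p ?q] dist_snd_le[of ?p ?q] by auto
      from d(2)[OF *(1)] *(2) show ?thesis by simp
    qed
    have shifted: "(inverse_limit_shift ^^ k) w = (\<lambda>i. fst w (i + int k), \<lambda>i. snd w (i + int k))"
      for w :: "(int \<Rightarrow> nat) \<times> (int \<Rightarrow> 'a)"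
      by (cases w) (simp add: funpow_inverse_limit_shift)
    have idx: "\<exists>i\<le>2 * k. j + int k = int i" if "j \<in> J \<union> J'" for j
      using k[OF that] by (intro exI[of _ "nat (j + int k)"]) auto
    have "dist (\<lambda>i. fst u (i + int k)) (\<lambda>i. fst v (i + int k)) \<le> \<epsilon> / 2"
    proof (rule J(3))
      fix j assume "j \<in> J"
      then obtain i where "i \<le> 2 * k" "j + int k = int i" using idx by blast
      then show "dist (fst u (j + int k)) (fst v (j + int k)) \<le> e" using close' by simp
    qed
    moreover have "dist (\<lambda>i. snd u (i + int k)) (\<lambda>i. snd v (i + int k)) \<le> \<epsilon> / 2"
    proof (rule J'(3))
      fix j assume "j \<in> J'"
      then obtain i where "i \<le> 2 * k" "j + int k = int i" using idx by blast
      then show "dist (snd u (j + int k)) (snd v (j + int k)) \<le> e'" using close' by simp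
    qed
    ultimately show "dist ((inverse_limit_shift ^^ k) u) ((inverse_limit_shift ^^ k) v) \<le> \<epsilon>"
      using dist_prod_le[of "(inverse_limit_shift ^^ k) u" "(inverse_limit_shift ^^ k) v"]
      by (simp add: shifted)
  qed simp
qed

theorem topological_pressure_inverse_limit:
  fixes X :: "'a::metric_space set"
  assumes X: "compact X"
    and f: "\<And>j. j \<in> {1..m} \<Longrightarrow> f j \<in> X \<rightarrow> X" "\<And>j. j \<in> {1..m} \<Longrightarrow> continuous_on X (f j)"
    and \<phi>: "\<And>j. j \<in> {1..m} \<Longrightarrow> continuous_on X (\<phi> j)"
  shows "topological_pressure (one_sided m \<times> X) (skew_product f) (skew_potential \<phi>)
    = topological_pressure (inverse_limit m X f) inverse_limit_shift (inverse_limit_potential \<phi>)"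
proof (rule antisym)
  have K: "compact (one_sided m \<times> X)" by (intro compact_Times compact_one_sided X)
  have \<psi>: "continuous_on (one_sided m \<times> X) (skew_potential \<phi>)"
    unfolding skew_potential_def by (rule continuous_on_fibrewise[OF X \<phi>])
  show "topological_pressure (one_sided m \<times> X) (skew_product f) (skew_potential \<phi>)
      \<le> topological_pressure (inverse_limit m X f) inverse_limit_shift (inverse_limit_potential \<phi>)"
    unfolding inverse_limit_potential_eq
    by (rule topological_pressure_le_extension[OF K continuous_on_skew_product[OF X f(2)]
          skew_product_image_subset[OF f(1)] \<psi> inverse_limit_shift_mem inverse_limit_proj_shift
          inverse_limit_proj_mem core_subset_inverse_limit_proj[OF X f] uniform_inverse_limit_proj])
  show "topological_pressure (inverse_limit m X f) inverse_limit_shift (inverse_limit_potential \<phi>)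
      \<le> topological_pressure (one_sided m \<times> X) (skew_product f) (skew_potential \<phi>)"
    unfolding inverse_limit_potential_eq
    by (rule topological_pressure_extension_le[OF K skew_product_image_subset[OF f(1)] \<psi>
          inverse_limit_shift_mem inverse_limit_proj_shift inverse_limit_proj_mem
          inverse_limit_shift_onto inverse_limit_generator])
qed

section \<open>Words and skew product orbits\<close>

text \<open>The default 1 is a symbol of the alphabet as soon as \<open>1 \<le> m\<close>, so every
  word becomes the beginning of an admissible sequence.\<close>

definition extend_word :: "nat list \<Rightarrow> nat \<Rightarrow> nat" where
  "extend_word C = (\<lambda>i. if i < length C then C ! i else 1)"

lemma seq_prefix_extend_word: "seq_prefix (length C) (extend_word C) = C"
  by (auto simp: seq_prefix_def extend_word_def intro: nth_equalityI)

lemma extend_word_mem: "1 \<le> m \<Longrightarrow> set C \<subseteq> {1..m} \<Longrightarrow> extend_word C \<in> one_sided m"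
  by (auto simp: one_sided_def extend_word_def subset_iff)

lemma length_seq_prefix: "length (seq_prefix n \<omega>) = n"
  by (simp add: seq_prefix_def)

lemma seq_prefix_mem: "\<omega> \<in> one_sided m \<Longrightarrow> seq_prefix n \<omega> \<in> {C. set C \<subseteq> {1..m} \<and> length C = n}"
  by (auto simp: one_sided_def seq_prefix_def)

lemma seq_prefix_eqI: "(\<And>i. i < n \<Longrightarrow> \<omega> i = \<omega>' i) \<Longrightarrow> seq_prefix n \<omega> = seq_prefix n \<omega>'"
  by (simp add: seq_prefix_def)

lemma finite_image_seq_prefix: "finite (seq_prefix n ` one_sided m)"
  by (rule finite_subset[of _ "{C. set C \<subseteq> {1..m} \<and> length C = n}"])
    (use seq_prefix_mem in \<open>auto intro: finite_lists_length_eq\<close>)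

text \<open>The separate initial condition of \<open>word_ball\<close> is the case
  \<open>k = 0\<close>. Time \<open>n\<close> is included, one more than in a spanning condition of
  length \<open>n\<close>.\<close>

lemma word_ball_seq_prefix_iff:
  "z \<in> word_ball X f y (seq_prefix n \<omega>) \<epsilon> \<longleftrightarrow> z \<in> X \<and>
    (\<forall>k\<le>n. dist (snd ((skew_product f ^^ k) (\<omega>, y))) (snd ((skew_product f ^^ k) (\<omega>, z))) < \<epsilon>)"
proof -
  have "(\<forall>k\<le>n. P k) \<longleftrightarrow> P 0 \<and> (\<forall>k\<in>{1..n}. P k)" for P :: "nat \<Rightarrow> bool"
  proof (intro iffI allI impI)
    fix k assume "P 0 \<and> (\<forall>k\<in>{1..n}. P k)" "k \<le> n"
    then show "P k" by (cases k) auto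
  qed auto
  then show ?thesis
    by (simp add: word_ball_def funpow_skew_product length_seq_prefix take_seq_prefix)
      (simp add: seq_prefix_def word_map_def)
qed

section \<open>The amalgamated pressure\<close>

lemma word_ball_mono: "a \<le> b \<Longrightarrow> word_ball X f y C a \<subseteq> word_ball X f y C b"
  unfolding word_ball_def by (auto intro: less_le_trans)

lemma amalg_covers_mono:
  assumes "N' \<le> N" "a \<le> b"
  shows "amalg_covers m X f N a \<subseteq> amalg_covers m X f N' b"
proof
  fix \<Gamma> assume G: "\<Gamma> \<in> amalg_covers m X f N a"
  have "(\<Union>(C, y)\<in>\<Gamma>. word_ball X f y C a) \<subseteq> (\<Union>(C, y)\<in>\<Gamma>. word_ball X f y C b)"
    by (intro UN_mono order_refl) (auto dest: subsetD[OF word_ball_mono[OF assms(2)]])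
  then show "\<Gamma> \<in> amalg_covers m X f N' b"
    using G assms(1) unfolding amalg_covers_def by (auto intro: le_trans)
qed

lemma amalg_M_mono:
  assumes "N' \<le> N" "a \<le> b"
  shows "amalg_M m X f \<phi> s N' b \<le> amalg_M m X f \<phi> s N a"
  unfolding amalg_M_def by (rule INF_superset_mono[OF amalg_covers_mono[OF assms]]) simp

lemma amalg_m_eq_0_iff: "amalg_m m X f \<phi> s \<epsilon> = 0 \<longleftrightarrow> (\<forall>N. amalg_M m X f \<phi> s N \<epsilon> = 0)"
  unfolding amalg_m_def by (rule lim_mono_eq_0_iff) (auto intro!: monoI amalg_M_mono)

lemma amalgamated_pressure_eq_SUP:
  "amalgamated_pressure m X f \<phi> = (SUP \<epsilon>\<in>{0<..}. amalg_pressure_at m X f \<phi> \<epsilon>)"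
  unfolding amalgamated_pressure_def
proof (rule Lim_at_right_0_antimono_eq_SUP)
  fix a b :: real assume "a \<le> b"
  then have "amalg_M m X f \<phi> s N b = 0" if "amalg_M m X f \<phi> s N a = 0" for s N
    using amalg_M_mono[of N N a b m X f \<phi> s] that by simp
  then show "amalg_pressure_at m X f \<phi> b \<le> amalg_pressure_at m X f \<phi> a"
    unfolding amalg_pressure_at_def amalg_m_eq_0_iff by (intro Inf_superset_mono) auto
qed

lemma infsum_image_le:
  fixes g :: "'b \<Rightarrow> ennreal"
  assumes "finite E"
  shows "infsum g (h ` E) \<le> (\<Sum>e\<in>E. g (h e))"
  using sum_image_le[OF assms, of g h] assms by (simp add: comp_def)

text \<open>Spanning at length \<open>n + 1\<close> is required because word balls also control time
  \<open>n\<close>. The scale \<open>e\<close> forces equal first symbols, so a centre shadowing an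
  orbit along the chosen word starts with that very word. Thus the centres over the lightest word
  alone already cover \<open>X\<close>.\<close>

lemma amalg_M_le:
  fixes X :: "'a::metric_space set"
  assumes m: "1 \<le> m" and n: "1 \<le> n" "N \<le> n"
    and E: "finite E" "spanning (one_sided m \<times> X) (skew_product f) (n + 1) e E"
    and e: "\<And>p q :: (nat \<Rightarrow> nat) \<times> 'a. dist p q \<le> e \<Longrightarrow> fst p 0 = fst q 0 \<and> dist (snd p) (snd q) < \<epsilon>"
  shows "amalg_M m X f \<phi> s N \<epsilon> \<le> ennreal (exp (- s * real n) *
    ((\<Sum>p\<in>E. exp (birkhoff_sum (skew_product f) (skew_potential \<phi>) n p)) / real m ^ n))"
proof -
  let ?F = "skew_product f"
  let ?S = "birkhoff_sum ?F (skew_potential \<phi>) n"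
  define W where "W = {C. set C \<subseteq> {1..m} \<and> length C = n}"
  have W: "finite W" "card W = m ^ n"
    by (simp_all add: W_def finite_lists_length_eq card_lists_length_eq)
  define EC where "EC = (\<lambda>C. {p\<in>E. seq_prefix n (fst p) = C})"
  define g where "g = (\<lambda>C. \<Sum>p\<in>EC C. exp (?S p))"
  have EK: "E \<subseteq> one_sided m \<times> X" using E(2) by (simp add: spanning_def)
  have gsum: "(\<Sum>C\<in>W. g C) = (\<Sum>p\<in>E. exp (?S p))"
    unfolding g_def EC_def
  proof (rule sum.group[OF E(1) W(1)], clarify)
    fix \<omega> x assume "(\<omega>, x) \<in> E"
    then have "\<omega> \<in> one_sided m" using EK by blast
    then show "seq_prefix n (fst (\<omega>, x)) \<in> W" using seq_prefix_mem by (simp add: W_def)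
  qed
  \<comment> \<open>A minimum needs some word; here \<open>1 \<le> m\<close> enters.\<close>
  have "replicate n 1 \<in> W" using m by (auto simp: W_def)
  then have gW: "g ` W \<noteq> {}" by blast
  then have "Min (g ` W) \<in> g ` W" using W(1) by (intro Min_in) auto
  then obtain C where C: "C \<in> W" "g C = Min (g ` W)" by auto
  then have "real (card W) * g C \<le> (\<Sum>C\<in>W. g C)"
    using W(1) by (intro sum_bounded_below) auto
  then have gC: "g C \<le> (\<Sum>p\<in>E. exp (?S p)) / real m ^ n"
    using m unfolding gsum W(2) by (simp add: field_simps)
  have Cn: "length C = n" "set C \<subseteq> {1..m}" using C(1) by (auto simp: W_def)
  define \<Gamma> where "\<Gamma> = (\<lambda>p. (C, snd p)) ` EC C"
  have finEC: "finite (EC C)" using E(1) by (simp add: EC_def)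
  have "X \<subseteq> (\<Union>(C, y)\<in>\<Gamma>. word_ball X f y C \<epsilon>)"
  proof
    fix x assume x: "x \<in> X"
    \<comment> \<open>Every \<open>x\<close> is tested along the same word \<open>C\<close>, so the
      centre found for it belongs to \<open>EC C\<close>.\<close>
    define \<omega> where "\<omega> = extend_word C"
    have \<omega>: "\<omega> \<in> one_sided m" "seq_prefix n \<omega> = C"
      using extend_word_mem[OF m Cn(2)] seq_prefix_extend_word[of C] Cn(1) by (auto simp: \<omega>_def)
    with x E(2) obtain p where p: "p \<in> E" "\<forall>i<n + 1. dist ((?F ^^ i) (\<omega>, x)) ((?F ^^ i) p) \<le> e"
      unfolding spanning_def by blast
    obtain \<omega>' y where py: "p = (\<omega>', y)" by (cases p)
    have close: "\<omega> i = \<omega>' i \<and> dist (snd ((?F ^^ i) (\<omega>, x))) (snd ((?F ^^ i) (\<omega>', y))) < \<epsilon>" if "i \<le> n" for i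
      using e[of "(?F ^^ i) (\<omega>, x)" "(?F ^^ i) p"] p(2) that by (auto simp: funpow_skew_product py)
    then have pre: "seq_prefix k \<omega> = seq_prefix k \<omega>'" if "k \<le> n" for k
      using that by (intro seq_prefix_eqI) auto
    have "x \<in> word_ball X f y (seq_prefix n \<omega>') \<epsilon>"
      unfolding word_ball_seq_prefix_iff
    proof (intro conjI allI impI x)
      fix k assume k: "k \<le> n"
      have "snd ((?F ^^ k) (\<omega>', x)) = snd ((?F ^^ k) (\<omega>, x))"
        using pre[OF k] by (simp add: funpow_skew_product)
      then show "dist (snd ((?F ^^ k) (\<omega>', y))) (snd ((?F ^^ k) (\<omega>', x))) < \<epsilon>"
        using close[OF k] by (simp add: dist_commute)
    qed
    moreover have "seq_prefix n \<omega>' = C" using pre[of n] \<omega>(2) by simp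
    moreover from this have "(C, y) \<in> \<Gamma>" using p(1) by (force simp: \<Gamma>_def EC_def py)
    ultimately show "x \<in> (\<Union>(C, y)\<in>\<Gamma>. word_ball X f y C \<epsilon>)" by auto
  qed
  moreover have "\<Gamma> \<subseteq> words m \<times> X" "\<forall>(C, y)\<in>\<Gamma>. N \<le> length C"
    using Cn n EK by (auto simp: \<Gamma>_def EC_def words_def)
  moreover have "countable \<Gamma>" using finEC by (simp add: \<Gamma>_def countable_finite)
  ultimately have "\<Gamma> \<in> amalg_covers m X f N \<epsilon>" by (simp add: amalg_covers_def)
  then have "amalg_M m X f \<phi> s N \<epsilon>
      \<le> (\<Sum>\<^sub>\<infinity>(C, y)\<in>\<Gamma>. ennreal (exp (- s * real (length C) + word_sum f \<phi> y C)))"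
    unfolding amalg_M_def by (rule INF_lower)
  also have "\<dots> \<le> (\<Sum>p\<in>EC C. ennreal (exp (- s * real (length C) + word_sum f \<phi> (snd p) C)))"
    unfolding \<Gamma>_def
    using infsum_image_le[OF finEC, of "\<lambda>(C, y). ennreal (exp (- s * real (length C) + word_sum f \<phi> y C))"
        "\<lambda>p. (C, snd p)"] by simp
  also have "\<dots> = (\<Sum>p\<in>EC C. ennreal (exp (- s * real n) * exp (?S p)))"
  proof (rule sum.cong)
    fix p assume "p \<in> EC C"
    then have "word_sum f \<phi> (snd p) C = ?S p"
      using word_sum_seq_prefix[of f \<phi> "snd p" n "fst p"] by (auto simp: EC_def)
    then show "ennreal (exp (- s * real (length C) + word_sum f \<phi> (snd p) C)) = ennreal (exp (- s * real n) * exp (?S p))"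
      by (simp only: Cn(1) exp_add)
  qed simp
  also have "\<dots> = ennreal (exp (- s * real n) * g C)"
    by (simp add: g_def sum_distrib_left)
  also have "\<dots> \<le> ennreal (exp (- s * real n) * ((\<Sum>p\<in>E. exp (?S p)) / real m ^ n))"
    by (intro ennreal_leI mult_left_mono gC) simp
  finally show ?thesis .
qed

theorem amalgamated_pressure_le:
  fixes X :: "'a::metric_space set"
  assumes X: "compact X" and m: "1 \<le> m"
    and f: "\<And>j. j \<in> {1..m} \<Longrightarrow> f j \<in> X \<rightarrow> X"
    and \<phi>: "\<And>j. j \<in> {1..m} \<Longrightarrow> continuous_on X (\<phi> j)"
  shows "amalgamated_pressure m X f \<phi> + ereal (ln (real m))
    \<le> topological_pressure (one_sided m \<times> X) (skew_product f) (skew_potential \<phi>)"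
proof (rule ereal_le_if_le_add_real)
  let ?F = "skew_product f" and ?\<psi> = "skew_potential \<phi>" and ?K = "one_sided m \<times> X"
  fix c \<delta> :: real
  assume c: "topological_pressure ?K ?F ?\<psi> < ereal c" and \<delta>: "0 < \<delta>"
  \<comment> \<open>Division by \<open>m ^ n\<close> accounts for \<open>- ln m\<close>; the extra
    \<delta> leaves the decaying factor \<open>exp (- \<delta>) ^ n\<close>.\<close>
  define s where "s = c + \<delta> - ln (real m)"
  have K: "compact ?K" by (intro compact_Times compact_one_sided X)
  have F: "?F ` ?K \<subseteq> ?K" using f by (rule skew_product_image_subset)
  have \<psi>: "continuous_on ?K ?\<psi>"
    unfolding skew_potential_def by (rule continuous_on_fibrewise[OF X \<phi>])
  obtain b where b: "\<And>p. p \<in> ?K \<Longrightarrow> - b \<le> ?\<psi> p"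
    using continuous_on_compact_lower_bound[OF K \<psi>] by blast
  have "amalgamated_pressure m X f \<phi> \<le> ereal s"
    unfolding amalgamated_pressure_eq_SUP
  proof (rule SUP_least)
    fix \<epsilon> :: real assume "\<epsilon> \<in> {0<..}"
    then have \<epsilon>: "0 < \<epsilon>" by simp
    obtain d where d: "0 < d" "\<And>u v :: nat \<Rightarrow> nat. dist u v \<le> d \<Longrightarrow> dist (u 0) (v 0) < 1"
      using uniform_component[of 1 "0::nat", where ?'b = nat] by auto
    \<comment> \<open>\<open>d\<close> brings first symbols closer than 1, the distance between
      distinct symbols, so they agree; \<epsilon>/2 makes the second inequality strict.\<close>
    define e where "e = min d (\<epsilon> / 2)"
    have e0: "0 < e" using d(1) \<epsilon> by (simp add: e_def)
    have e: "fst p 0 = fst q 0 \<and> dist (snd p) (snd q) < \<epsilon>" if "dist p q \<le> e" for p q :: "(nat \<Rightarrow> nat) \<times> 'a"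
    proof -
      have "dist (fst p) (fst q) \<le> d" "dist (snd p) (snd q) \<le> \<epsilon> / 2"
        using that dist_fst_le[of p q] dist_snd_le[of p q] by (auto simp: e_def)
      with d(2)[of "fst p" "fst q"] \<epsilon> show ?thesis by (auto simp: dist_nat_def split: if_splits)
    qed
    have "amalg_M m X f \<phi> s N \<epsilon> = 0" for N
    proof -
      have "\<forall>\<^sub>F n in sequentially. \<exists>E. finite E \<and> spanning ?K ?F (n + 1) e E \<and>
          (\<Sum>p\<in>E. exp (birkhoff_sum ?F ?\<psi> (n + 1) p)) < exp (c * real (n + 1))"
        using eventually_spanning_if_topological_pressure_less[OF c e0]
        by (subst eventually_sequentially_seg)
      then have "\<forall>\<^sub>F n in sequentially. amalg_M m X f \<phi> s N \<epsilon> \<le> ennreal (exp (b + c) * exp (- \<delta>) ^ n)"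
        using eventually_ge_at_top[of 1] eventually_ge_at_top[of N]
      proof eventually_elim
        case (elim n)
        then obtain E where E: "finite E" "spanning ?K ?F (n + 1) e E"
          "(\<Sum>p\<in>E. exp (birkhoff_sum ?F ?\<psi> (n + 1) p)) < exp (c * real (n + 1))" by blast
        \<comment> \<open>Dropping the last term of the longer Birkhoff sum costs at most a factor
          \<open>exp b\<close>.\<close>
        have "(\<Sum>p\<in>E. exp (birkhoff_sum ?F ?\<psi> n p)) \<le> (\<Sum>p\<in>E. exp b * exp (birkhoff_sum ?F ?\<psi> (n + 1) p))"
        proof (rule sum_mono)
          fix p assume "p \<in> E"
          then have "p \<in> ?K" using E(2) by (auto simp: spanning_def)
          then have "(?F ^^ n) p \<in> ?K"
            using funpow_image_subset[OF F] by blast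
          then have "- b \<le> ?\<psi> ((?F ^^ n) p)" by (rule b)
          then have "birkhoff_sum ?F ?\<psi> n p \<le> b + birkhoff_sum ?F ?\<psi> (n + 1) p"
            by (simp add: birkhoff_sum_def)
          then show "exp (birkhoff_sum ?F ?\<psi> n p) \<le> exp b * exp (birkhoff_sum ?F ?\<psi> (n + 1) p)"
            by (simp flip: exp_add)
        qed
        also have "\<dots> \<le> exp b * exp (c * real (n + 1))"
          using E(3) by (simp flip: sum_distrib_left)
        finally have le: "(\<Sum>p\<in>E. exp (birkhoff_sum ?F ?\<psi> n p)) \<le> exp b * exp (c * real (n + 1))" .
        have "amalg_M m X f \<phi> s N \<epsilon> \<le> ennreal (exp (- s * real n) *
            ((\<Sum>p\<in>E. exp (birkhoff_sum ?F ?\<psi> n p)) / real m ^ n))"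
          by (rule amalg_M_le[OF m elim(2,3) E(1,2) e])
        also have "\<dots> \<le> ennreal (exp (- s * real n) * ((exp b * exp (c * real (n + 1))) / real m ^ n))"
          by (intro ennreal_leI mult_left_mono divide_right_mono le) auto
        also have "exp (- s * real n) * ((exp b * exp (c * real (n + 1))) / real m ^ n) = exp (b + c) * exp (- \<delta>) ^ n"
        proof -
          have "real m ^ n = exp (real n * ln (real m))" using m by (simp add: exp_of_nat_mult)
          then have "exp (- s * real n) * ((exp b * exp (c * real (n + 1))) / real m ^ n)
              = exp (- s * real n + (b + c * real (n + 1)) - real n * ln (real m))"
            by (simp only: exp_add exp_diff times_divide_eq_right)
          also have "- s * real n + (b + c * real (n + 1)) - real n * ln (real m) = (b + c) + real n * (- \<delta>)"
            by (simp add: s_def algebra_simps)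
          also have "exp ((b + c) + real n * (- \<delta>)) = exp (b + c) * exp (- \<delta>) ^ n"
            by (simp only: exp_add exp_of_nat_mult)
          finally show ?thesis .
        qed
        finally show ?case .
      qed
      \<comment> \<open>\<open>N\<close> stays fixed while \<open>n\<close> grows: words of every
        length \<open>n \<ge> N\<close> are admissible, so the infimum is pushed to 0.\<close>
      moreover have "(\<lambda>n. ennreal (exp (b + c) * exp (- \<delta>) ^ n)) \<longlonglongrightarrow> ennreal (exp (b + c) * 0)"
        using \<delta> by (intro tendsto_ennrealI tendsto_mult tendsto_const LIMSEQ_power_zero) simp
      ultimately have "amalg_M m X f \<phi> s N \<epsilon> \<le> ennreal (exp (b + c) * 0)"
        by (intro tendsto_lowerbound) auto
      then show ?thesis by simp
    qed
    then show "amalg_pressure_at m X f \<phi> \<epsilon> \<le> ereal s"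
      unfolding amalg_pressure_at_def by (intro Inf_lower) (auto simp: amalg_m_eq_0_iff)
  qed
  then have "amalgamated_pressure m X f \<phi> + ereal (ln (real m)) \<le> ereal s + ereal (ln (real m))"
    by (rule add_right_mono)
  then show "amalgamated_pressure m X f \<phi> + ereal (ln (real m)) \<le> ereal (c + \<delta>)"
    by (simp add: s_def)
qed

section \<open>The upper condensed pressure\<close>

lemma condensed_ball_mono: "a \<le> b \<Longrightarrow> condensed_ball m X f n x a \<subseteq> condensed_ball m X f n x b"
  unfolding condensed_ball_def by (intro INT_anti_mono word_ball_mono) auto

lemma upper_covers_mono:
  assumes "N' \<le> N" "a \<le> b"
  shows "upper_covers m X f N a \<subseteq> upper_covers m X f N' b"
proof clarify
  fix A n assume A: "(A, n) \<in> upper_covers m X f N a"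
  have "(\<Union>x\<in>A. condensed_ball m X f (n x) x a) \<subseteq> (\<Union>x\<in>A. condensed_ball m X f (n x) x b)"
    by (intro UN_mono order_refl condensed_ball_mono assms(2))
  then show "(A, n) \<in> upper_covers m X f N' b"
    using A assms(1) unfolding upper_covers_def by (auto intro: le_trans)
qed

lemma upper_M_mono:
  assumes "N' \<le> N" "a \<le> b"
  shows "upper_M m X f \<phi> s N' b \<le> upper_M m X f \<phi> s N a"
  unfolding upper_M_def by (rule INF_superset_mono[OF upper_covers_mono[OF assms]]) simp

lemma upper_m_eq_0_iff: "upper_m m X f \<phi> s \<epsilon> = 0 \<longleftrightarrow> (\<forall>N. upper_M m X f \<phi> s N \<epsilon> = 0)"
  unfolding upper_m_def by (rule lim_mono_eq_0_iff) (auto intro!: monoI upper_M_mono)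

lemma upper_condensed_pressure_eq_SUP:
  "upper_condensed_pressure m X f \<phi> = (SUP \<epsilon>\<in>{0<..}. upper_pressure_at m X f \<phi> \<epsilon>)"
  unfolding upper_condensed_pressure_def
proof (rule Lim_at_right_0_antimono_eq_SUP)
  fix a b :: real assume "a \<le> b"
  then have "upper_M m X f \<phi> s N b = 0" if "upper_M m X f \<phi> s N a = 0" for s N
    using upper_M_mono[of N N a b m X f \<phi> s] that by simp
  then show "upper_pressure_at m X f \<phi> b \<le> upper_pressure_at m X f \<phi> a"
    unfolding upper_pressure_at_def upper_m_eq_0_iff by (intro Inf_superset_mono) auto
qed

section \<open>Condensed balls as blocks for the renewal argument\<close>

text \<open>Only finitely many words of length \<open>n\<close> occur, so the intersection over all
  sequences is finite. Openness is what later reduces a countable cover to a finite one.\<close>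

lemma openin_condensed_ball:
  fixes X :: "'a::metric_space set"
  assumes "1 \<le> m" "compact X"
    and f: "\<And>j. j \<in> {1..m} \<Longrightarrow> f j \<in> X \<rightarrow> X" "\<And>j. j \<in> {1..m} \<Longrightarrow> continuous_on X (f j)"
  shows "openin (top_of_set X) (condensed_ball m X f n x e)"
proof -
  let ?F = "skew_product f"
  have ball: "openin (top_of_set X) (word_ball X f x (seq_prefix n \<omega>) e)" if \<omega>: "\<omega> \<in> one_sided m" for \<omega>
  proof -
    have cont: "continuous_on X (\<lambda>z. snd ((?F ^^ k) (\<omega>, z)))" for k
    proof (rule continuous_on_snd)
      have "continuous_on (one_sided m \<times> X) (?F ^^ k)"
        by (intro continuous_on_funpow continuous_on_skew_product skew_product_image_subset assms)
      then show "continuous_on X (\<lambda>z. (?F ^^ k) (\<omega>, z))"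
        by (rule continuous_on_compose2) (use \<omega> in \<open>auto intro: continuous_intros\<close>)
    qed
    have "openin (top_of_set X)
        ((\<Inter>k\<le>n. X \<inter> (\<lambda>z. snd ((?F ^^ k) (\<omega>, z))) -` ball (snd ((?F ^^ k) (\<omega>, x))) e) \<inter> topspace (top_of_set X))"
      by (rule openin_INT) (auto intro: continuous_openin_preimage_gen cont)
    also have "(\<Inter>k\<le>n. X \<inter> (\<lambda>z. snd ((?F ^^ k) (\<omega>, z))) -` ball (snd ((?F ^^ k) (\<omega>, x))) e) \<inter> topspace (top_of_set X)
        = word_ball X f x (seq_prefix n \<omega>) e"
      by (rule set_eqI) (auto simp: word_ball_seq_prefix_iff)
    finally show ?thesis .
  qed
  have "extend_word [] \<in> one_sided m" using assms(1) by (intro extend_word_mem) auto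
  then have ne: "(\<lambda>C. word_ball X f x C e) ` seq_prefix n ` one_sided m \<noteq> {}" by blast
  have "condensed_ball m X f n x e = \<Inter>((\<lambda>C. word_ball X f x C e) ` seq_prefix n ` one_sided m)"
    by (simp add: condensed_ball_def)
  also have "openin (top_of_set X) \<dots>"
    by (rule openin_Inter[OF finite_imageI[OF finite_image_seq_prefix] ne]) (use ball in auto)
  finally show ?thesis .
qed

lemma word_sum_le_upper_sum:
  assumes "\<omega> \<in> one_sided m"
  shows "word_sum f \<phi> x (seq_prefix n \<omega>) \<le> upper_sum m f \<phi> n x"
  unfolding upper_sum_def
proof (rule cSUP_upper[OF assms])
  have "(\<lambda>\<omega>. word_sum f \<phi> x (seq_prefix n \<omega>)) ` one_sided m = word_sum f \<phi> x ` seq_prefix n ` one_sided m"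
    by (simp add: image_image)
  then show "bdd_above ((\<lambda>\<omega>. word_sum f \<phi> x (seq_prefix n \<omega>)) ` one_sided m)"
    using finite_image_seq_prefix by simp
qed

text \<open>Symbol \<open>j\<close> of a sequence is its first symbol after \<open>j\<close> steps.
  Relations that read only first symbols therefore suffice, at the cost of \<open>l\<close> further
  steps.\<close>

lemma skew_product_generator:
  assumes "0 < \<epsilon>"
  obtains l where "\<And>p q :: (nat \<Rightarrow> nat) \<times> 'a::metric_space.
    (\<And>j. j \<le> l \<Longrightarrow> fst ((skew_product f ^^ j) p) 0 = fst ((skew_product f ^^ j) q) 0) \<Longrightarrow>
    dist (snd p) (snd q) \<le> \<epsilon> / 2 \<Longrightarrow> dist p q \<le> \<epsilon>"
proof -
  have e2: "0 < \<epsilon> / 2" using assms by simp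
  obtain J :: "nat set" and \<eta> where J: "finite J" "0 < \<eta>"
    "\<And>u v :: nat \<Rightarrow> nat. (\<And>j. j \<in> J \<Longrightarrow> dist (u j) (v j) \<le> \<eta>) \<Longrightarrow> dist u v \<le> \<epsilon> / 2"
    using dist_fun_le_if_finitely_many_components[OF e2, where ?'i = nat and ?'b = nat] by blast
  show thesis
  proof (rule that[of "Max (insert 0 J)"])
    fix p q :: "(nat \<Rightarrow> nat) \<times> 'a"
    assume eq: "\<And>j. j \<le> Max (insert 0 J) \<Longrightarrow> fst ((skew_product f ^^ j) p) 0 = fst ((skew_product f ^^ j) q) 0"
      and snd: "dist (snd p) (snd q) \<le> \<epsilon> / 2"
    have "dist (fst p) (fst q) \<le> \<epsilon> / 2"
    proof (rule J(3))
      fix j assume "j \<in> J"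
      then have "fst p j = fst q j"
        using eq[of j] J(1) by (cases p; cases q) (auto simp: funpow_skew_product)
      then show "dist (fst p j) (fst q j) \<le> \<eta>" using J(2) by simp
    qed
    with snd dist_prod_le[of p q] show "dist p q \<le> \<epsilon>" by linarith
  qed
qed

text \<open>A condensed ball controls all words at once, so one centre above \<open>x\<close>
  suffices for each of the \<open>m ^ n\<close> words, with Birkhoff sum at most
  \<open>upper_sum\<close>. This count is the origin of \<open>log m\<close> in the upper
  bound.\<close>

lemma bowen_cover_condensed_ball:
  fixes X :: "'a::metric_space set"
  assumes m: "1 \<le> m" and f: "\<And>j. j \<in> {1..m} \<Longrightarrow> f j \<in> X \<rightarrow> X" and x: "x \<in> X"
    and VU: "\<And>p q r. V p r \<Longrightarrow> V q r \<Longrightarrow> U p q"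
    and V\<psi>: "\<And>p r. V p r \<Longrightarrow> skew_potential \<phi> p \<le> skew_potential \<phi> r + \<delta>"
    and V: "\<And>p r. p \<in> one_sided m \<times> X \<Longrightarrow> r \<in> one_sided m \<times> X \<Longrightarrow> fst p 0 = fst r 0 \<Longrightarrow>
      dist (snd r) (snd p) < e \<Longrightarrow> V p r"
  shows "bowen_cover (skew_product f) (skew_potential \<phi>) U n (one_sided m \<times> condensed_ball m X f n x e)
    (exp (\<delta> * real n) * (real m ^ n * exp (upper_sum m f \<phi> n x)))"
proof (rule bowen_cover_mono)
  let ?F = "skew_product f" and ?\<psi> = "skew_potential \<phi>"
  define W where "W = {C. set C \<subseteq> {1..m} \<and> length C = n}"
  have W: "finite W" "card W = m ^ n"
    by (simp_all add: W_def finite_lists_length_eq card_lists_length_eq)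
  define E where "E = (\<lambda>C. (extend_word C, x)) ` W"
  have finE: "finite E" using W(1) by (simp add: E_def)
  show "bowen_cover ?F ?\<psi> U n (\<Union>r\<in>E. {p. \<forall>i<n. V ((?F ^^ i) p) ((?F ^^ i) r)})
      (exp (\<delta> * real n) * (\<Sum>r\<in>E. exp (birkhoff_sum ?F ?\<psi> n r)))"
    using finE VU V\<psi> by (rule bowen_cover_balls)
  have orb: "(?F ^^ i) p \<in> one_sided m \<times> X" if "p \<in> one_sided m \<times> X" for i p
  proof -
    have "?F ` (one_sided m \<times> X) \<subseteq> one_sided m \<times> X" using f by (rule skew_product_image_subset)
    from funpow_image_subset[OF this] that show ?thesis by blast
  qed
  show "one_sided m \<times> condensed_ball m X f n x e \<subseteq> (\<Union>r\<in>E. {p. \<forall>i<n. V ((?F ^^ i) p) ((?F ^^ i) r)})"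
  proof clarify
    fix \<omega> z assume \<omega>: "\<omega> \<in> one_sided m" and "z \<in> condensed_ball m X f n x e"
    then have "z \<in> word_ball X f x (seq_prefix n \<omega>) e" by (auto simp: condensed_ball_def)
    then have z: "z \<in> X"
      "\<And>k. k \<le> n \<Longrightarrow> dist (snd ((?F ^^ k) (\<omega>, x))) (snd ((?F ^^ k) (\<omega>, z))) < e"
      unfolding word_ball_seq_prefix_iff by auto
    define C where "C = seq_prefix n \<omega>"
    have C: "C \<in> W" using seq_prefix_mem[OF \<omega>] by (simp add: C_def W_def)
    then have eC: "extend_word C \<in> one_sided m" using m by (intro extend_word_mem) (auto simp: W_def)
    have ext: "extend_word C i = \<omega> i" if "i < n" for i
      using that by (simp add: extend_word_def C_def seq_prefix_def)
    have "V ((?F ^^ i) (\<omega>, z)) ((?F ^^ i) (extend_word C, x))" if i: "i < n" for i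
    proof (rule V)
      show "(?F ^^ i) (\<omega>, z) \<in> one_sided m \<times> X" "(?F ^^ i) (extend_word C, x) \<in> one_sided m \<times> X"
        using \<omega> z(1) eC x by (auto intro!: orb)
      show "fst ((?F ^^ i) (\<omega>, z)) 0 = fst ((?F ^^ i) (extend_word C, x)) 0"
        using ext[OF i] by (simp add: funpow_skew_product)
      have "seq_prefix i (extend_word C) = seq_prefix i \<omega>" using ext i by (intro seq_prefix_eqI) auto
      then have "snd ((?F ^^ i) (extend_word C, x)) = snd ((?F ^^ i) (\<omega>, x))"
        by (simp add: funpow_skew_product)
      then show "dist (snd ((?F ^^ i) (extend_word C, x))) (snd ((?F ^^ i) (\<omega>, z))) < e"
        using z(2)[of i] i by simp
    qed
    moreover have "(extend_word C, x) \<in> E" using C by (simp add: E_def)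
    ultimately show "(\<omega>, z) \<in> (\<Union>r\<in>E. {p. \<forall>i<n. V ((?F ^^ i) p) ((?F ^^ i) r)})" by blast
  qed
  have "(\<Sum>r\<in>E. exp (birkhoff_sum ?F ?\<psi> n r)) \<le> (\<Sum>C\<in>W. exp (birkhoff_sum ?F ?\<psi> n (extend_word C, x)))"
    unfolding E_def
    using sum_image_le[OF W(1), of "\<lambda>r. exp (birkhoff_sum ?F ?\<psi> n r)" "\<lambda>C. (extend_word C, x)"]
    by (simp add: comp_def)
  also have "\<dots> \<le> (\<Sum>C\<in>W. exp (upper_sum m f \<phi> n x))"
    using m by (intro sum_mono)
      (auto simp: W_def word_sum_seq_prefix[symmetric] intro!: word_sum_le_upper_sum extend_word_mem)
  also have "\<dots> = real m ^ n * exp (upper_sum m f \<phi> n x)" by (simp add: W(2))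
  finally show "exp (\<delta> * real n) * (\<Sum>r\<in>E. exp (birkhoff_sum ?F ?\<psi> n r))
      \<le> exp (\<delta> * real n) * (real m ^ n * exp (upper_sum m f \<phi> n x))" by simp
qed

theorem topological_pressure_le_upper_condensed_pressure:
  fixes X :: "'a::metric_space set"
  assumes X: "compact X" and m: "1 \<le> m"
    and f: "\<And>j. j \<in> {1..m} \<Longrightarrow> f j \<in> X \<rightarrow> X" "\<And>j. j \<in> {1..m} \<Longrightarrow> continuous_on X (f j)"
    and \<phi>: "\<And>j. j \<in> {1..m} \<Longrightarrow> continuous_on X (\<phi> j)"
  shows "topological_pressure (one_sided m \<times> X) (skew_product f) (skew_potential \<phi>)
    \<le> upper_condensed_pressure m X f \<phi> + ereal (ln (real m))"
proof (rule ereal_le_if_le_add_real)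
  let ?F = "skew_product f" and ?\<psi> = "skew_potential \<phi>" and ?K = "one_sided m \<times> X"
  fix c \<delta> :: real
  assume c: "upper_condensed_pressure m X f \<phi> + ereal (ln (real m)) < ereal c" and \<delta>: "0 < \<delta>"
  have c': "upper_condensed_pressure m X f \<phi> < ereal (c - ln (real m))"
    using c by (cases "upper_condensed_pressure m X f \<phi>") auto
  have K: "compact ?K" by (intro compact_Times compact_one_sided X)
  have F: "?F ` ?K \<subseteq> ?K" using f(1) by (rule skew_product_image_subset)
  have \<psi>: "continuous_on ?K ?\<psi>"
    unfolding skew_potential_def by (rule continuous_on_fibrewise[OF X \<phi>])
  obtain b where b: "\<And>p. p \<in> ?K \<Longrightarrow> - b \<le> ?\<psi> p"
    using continuous_on_compact_lower_bound[OF K \<psi>] by blast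
  obtain \<eta> where \<eta>: "0 < \<eta>" "\<And>p r. p \<in> ?K \<Longrightarrow> r \<in> ?K \<Longrightarrow> dist p r < \<eta> \<Longrightarrow> ?\<psi> p \<le> ?\<psi> r + \<delta>"
    using uniform_modulus[OF K \<psi> \<delta>] by blast
  show "topological_pressure ?K ?F ?\<psi> \<le> ereal (c + \<delta>)"
  proof (rule topological_pressure_leI)
    fix \<epsilon> :: real assume \<epsilon>: "0 < \<epsilon>"
    \<comment> \<open>Passing through a centre gives at most \<epsilon>/2 in \<open>X\<close>; the
      other half is reserved for the symbol sequences.\<close>
    define e where "e = min \<eta> (\<epsilon> / 4)"
    have e: "0 < e" "e \<le> \<eta>" "e \<le> \<epsilon> / 4" using \<eta>(1) \<epsilon> by (auto simp: e_def)
    define V where "V = (\<lambda>p r. p \<in> ?K \<and> r \<in> ?K \<and> fst p 0 = fst r 0 \<and> dist (snd p) (snd r) < e)"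
    define U where "U = (\<lambda>(p :: (nat \<Rightarrow> nat) \<times> 'a) (q :: (nat \<Rightarrow> nat) \<times> 'a). fst p 0 = fst q 0 \<and> dist (snd p) (snd q) \<le> \<epsilon> / 2)"
    have VU: "U p q" if "V p r" "V q r" for p q r
      using that e(3) dist_triangle2[of "snd p" "snd q" "snd r"] by (auto simp: V_def U_def)
    have V\<psi>: "?\<psi> p \<le> ?\<psi> r + \<delta>" if "V p r" for p r
    proof -
      obtain \<omega> x \<omega>' z where pr: "p = (\<omega>, x)" "r = (\<omega>', z)" by (cases p, cases r)
      \<comment> \<open>The potential reads only the first symbol, so the sequences may be made
        equal before the modulus is applied; the distance is then the one in
        \<open>X\<close>.\<close>
      have "?\<psi> (\<omega>, x) \<le> ?\<psi> (\<omega>, z) + \<delta>"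
        using that e(2) by (intro \<eta>(2)) (auto simp: V_def pr dist_Pair_Pair)
      also have "?\<psi> (\<omega>, z) = ?\<psi> r" using that by (simp add: V_def pr skew_potential_def)
      finally show ?thesis by (simp add: pr)
    qed
    have "upper_pressure_at m X f \<phi> e < ereal (c - ln (real m))"
      by (rule le_less_trans[OF _ c']) (use e(1) in \<open>auto simp: upper_condensed_pressure_eq_SUP intro: SUP_upper\<close>)
    then obtain s where s: "s < c - ln (real m)" "upper_m m X f \<phi> s e = 0"
      unfolding upper_pressure_at_def by (auto simp: Inf_less_iff)
    \<comment> \<open>Minimal length 1 makes all block lengths positive, and total weight below 1 is
      the renewal condition.\<close>
    then have "upper_M m X f \<phi> s 1 e < 1" by (simp add: upper_m_eq_0_iff)
    then obtain A n where A: "(A, n) \<in> upper_covers m X f 1 e"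
      "(\<Sum>\<^sub>\<infinity>x\<in>A. ennreal (exp (upper_sum m f \<phi> (n x) x - s * real (n x)))) < 1"
      unfolding upper_M_def INF_less_iff by auto
    have AX: "A \<subseteq> X" "\<And>x. x \<in> A \<Longrightarrow> 1 \<le> n x" "X \<subseteq> (\<Union>x\<in>A. condensed_ball m X f (n x) x e)"
      using A(1) by (auto simp: upper_covers_def)
    have "\<forall>x. \<exists>O'. open O' \<and> condensed_ball m X f (n x) x e = X \<inter> O'"
      using openin_condensed_ball[OF m X, of f] f unfolding openin_open by blast
    then obtain O' where O': "\<And>x. open (O' x)" "\<And>x. condensed_ball m X f (n x) x e = X \<inter> O' x" by metis
    obtain A' where A': "A' \<subseteq> A" "finite A'" "X \<subseteq> (\<Union>x\<in>A'. O' x)"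
      by (rule compactE_image[OF X, of A O']) (use O' AX(3) in auto)
    have "(\<Sum>x\<in>A'. ennreal (exp (upper_sum m f \<phi> (n x) x - s * real (n x))))
        \<le> (\<Sum>\<^sub>\<infinity>x\<in>A. ennreal (exp (upper_sum m f \<phi> (n x) x - s * real (n x))))"
      using A' by (subst nonneg_infsum_complete) (auto intro: SUP_upper)
    also note A(2)
    finally have sumA: "(\<Sum>x\<in>A'. exp (upper_sum m f \<phi> (n x) x - s * real (n x))) \<le> 1"
      by (simp add: sum_nonneg ennreal_less_one_iff)
    obtain R0 where R0: "bowen_cover ?F ?\<psi> U 1 ?K R0"
    proof (rule bowen_cover_1_compact[OF K, of "\<lambda>r. ((\<lambda>\<omega>. \<omega> 0) -` {fst r 0}) \<times> ball (snd r) e" V U ?\<psi> \<delta> ?F])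
      fix r :: "(nat \<Rightarrow> nat) \<times> 'a"
      have "open ((\<lambda>\<omega>. \<omega> 0) -` {fst r 0} :: (nat \<Rightarrow> nat) set)"
        by (intro open_vimage continuous_on_product_coordinates) (rule open_discrete)
      then show "open (((\<lambda>\<omega> :: nat \<Rightarrow> nat. \<omega> 0) -` {fst r 0}) \<times> ball (snd r) e) \<and>
          r \<in> ((\<lambda>\<omega>. \<omega> 0) -` {fst r 0}) \<times> ball (snd r) e"
        using e(1) by (auto intro: open_Times simp: mem_Times_iff)
    qed (use VU V\<psi> in \<open>auto simp: V_def dist_commute\<close>)
    have "\<exists>B. \<forall>k. bowen_cover ?F ?\<psi> U k ?K (B * exp ((c + \<delta>) * real k))"
    proof (rule bowen_cover_renewal[OF F R0 A'(2), where D = "\<lambda>x. one_sided m \<times> condensed_ball m X f (n x) x e"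
          and l = n and R = "\<lambda>x. exp (\<delta> * real (n x)) * (real m ^ n x * exp (upper_sum m f \<phi> (n x) x))"])
      show "?K \<subseteq> (\<Union>x\<in>A'. one_sided m \<times> condensed_ball m X f (n x) x e)"
        using A'(3) O'(2) by auto
      show "one_sided m \<times> condensed_ball m X f (n x) x e \<subseteq> ?K" for x
        using O'(2) by auto
      show "0 < n x" if "x \<in> A'" for x using AX(2)[of x] A'(1) that by auto
      show "bowen_cover ?F ?\<psi> U (n x) (one_sided m \<times> condensed_ball m X f (n x) x e)
          (exp (\<delta> * real (n x)) * (real m ^ n x * exp (upper_sum m f \<phi> (n x) x)))" if "x \<in> A'" for x
      proof (rule bowen_cover_condensed_ball[OF m f(1), where V = V])
        show "x \<in> X" using that A'(1) AX(1) by blast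
      qed (use VU V\<psi> in \<open>auto simp: V_def dist_commute\<close>)
      \<comment> \<open>With \<open>m ^ n x\<close> written as an exponential, both \<delta> and
        \<open>ln m\<close> are absorbed by the target rate, and \<open>s < c - ln m\<close> leaves
        the weight of the given cover.\<close>
      have "exp (\<delta> * real (n x)) * (real m ^ n x * exp (upper_sum m f \<phi> (n x) x)) * exp (- (c + \<delta>) * real (n x))
          \<le> exp (upper_sum m f \<phi> (n x) x - s * real (n x))" for x
      proof -
        have mpow: "real m ^ n x = exp (real (n x) * ln (real m))" using m by (simp add: exp_of_nat_mult)
        have "exp (\<delta> * real (n x)) * (real m ^ n x * exp (upper_sum m f \<phi> (n x) x)) * exp (- (c + \<delta>) * real (n x))
            = exp (\<delta> * real (n x) + (real (n x) * ln (real m) + upper_sum m f \<phi> (n x) x) + - (c + \<delta>) * real (n x))"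
          by (simp only: exp_add mpow)
        also have "\<delta> * real (n x) + (real (n x) * ln (real m) + upper_sum m f \<phi> (n x) x) + - (c + \<delta>) * real (n x)
            = upper_sum m f \<phi> (n x) x - (c - ln (real m)) * real (n x)"
          by (simp add: algebra_simps)
        also have "exp \<dots> \<le> exp (upper_sum m f \<phi> (n x) x - s * real (n x))"
          using s(1) by (simp add: mult_right_mono)
        finally show ?thesis .
      qed
      then show "(\<Sum>x\<in>A'. exp (\<delta> * real (n x)) * (real m ^ n x * exp (upper_sum m f \<phi> (n x) x))
          * exp (- (c + \<delta>) * real (n x))) \<le> 1"
        by (intro order_trans[OF sum_mono sumA])
    qed
    then obtain B where B: "\<And>k. bowen_cover ?F ?\<psi> U k ?K (B * exp ((c + \<delta>) * real k))" by blast
    obtain l where l: "\<And>p q :: (nat \<Rightarrow> nat) \<times> 'a.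
      (\<And>j. j \<le> l \<Longrightarrow> fst ((?F ^^ j) p) 0 = fst ((?F ^^ j) q) 0) \<Longrightarrow>
      dist (snd p) (snd q) \<le> \<epsilon> / 2 \<Longrightarrow> dist p q \<le> \<epsilon>"
      using skew_product_generator[OF \<epsilon>, of f] by blast
    have "spanning_weight ?K ?F ?\<psi> k \<epsilon> \<le> ennreal ((B * exp ((c + \<delta>) * real l) * exp (b * real l)) * exp ((c + \<delta>) * real k))" for k
    proof -
      \<comment> \<open>The comparison is of the skew product with itself; the delay is 0, while
        \<open>l\<close> more steps recover the sequence distance from first symbols.\<close>
      have "spanning_weight ?K ?F (?\<psi> \<circ> id) k \<epsilon> \<le> ennreal (B * exp ((c + \<delta>) * real (k + l)) * exp (b * real l))"
      proof (rule spanning_weight_le_bowen_cover[OF B F, where k = 0])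
        fix u v
        assume *: "\<And>j. j \<le> l \<Longrightarrow> U ((?F ^^ j) (id u)) ((?F ^^ j) (id v))"
        have "dist u v \<le> \<epsilon>"
          using * *[of 0] by (intro l) (auto simp: U_def)
        then show "dist ((?F ^^ 0) u) ((?F ^^ 0) v) \<le> \<epsilon>" by simp
      qed (use F b in auto)
      then show ?thesis by (simp add: distrib_left exp_add ac_simps)
    qed
    then show "\<exists>D. \<forall>\<^sub>F k in sequentially. spanning_weight ?K ?F ?\<psi> k \<epsilon> \<le> ennreal (D * exp ((c + \<delta>) * real k))"
      by (intro exI always_eventually allI)
  qed
qed

theorem theorem4p3:
  fixes X :: "'a::metric_space set"
    and m :: nat
    and f :: "nat \<Rightarrow> 'a \<Rightarrow> 'a"
    and \<phi> :: "nat \<Rightarrow> 'a \<Rightarrow> real"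
  assumes "compact X"
    and "1 \<le> m"
    and "\<And>j. j \<in> {1..m} \<Longrightarrow> f j \<in> X \<rightarrow> X"
    and "\<And>j. j \<in> {1..m} \<Longrightarrow> continuous_on X (f j)"
    and "\<And>j. j \<in> {1..m} \<Longrightarrow> continuous_on X (\<phi> j)"
  shows "amalgamated_pressure m X f \<phi> + ereal (ln (real m))
           \<le> topological_pressure (one_sided m \<times> X) (skew_product f) (skew_potential \<phi>) \<and>
         topological_pressure (one_sided m \<times> X) (skew_product f) (skew_potential \<phi>)
           = topological_pressure (inverse_limit m X f) inverse_limit_shift
               (inverse_limit_potential \<phi>) \<and>
         topological_pressure (inverse_limit m X f) inverse_limit_shift (inverse_limit_potential \<phi>)
           \<le> upper_condensed_pressure m X f \<phi> + ereal (ln (real m))"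
proof -
  have "amalgamated_pressure m X f \<phi> + ereal (ln (real m))
      \<le> topological_pressure (one_sided m \<times> X) (skew_product f) (skew_potential \<phi>)"
    using assms(1,2,3,5) by (rule amalgamated_pressure_le)
  moreover have eq: "topological_pressure (one_sided m \<times> X) (skew_product f) (skew_potential \<phi>)
      = topological_pressure (inverse_limit m X f) inverse_limit_shift (inverse_limit_potential \<phi>)"
    using assms(1,3,4,5) by (rule topological_pressure_inverse_limit)
  moreover have "topological_pressure (one_sided m \<times> X) (skew_product f) (skew_potential \<phi>)
      \<le> upper_condensed_pressure m X f \<phi> + ereal (ln (real m))"
    using assms by (rule topological_pressure_le_upper_condensed_pressure)
  ultimately show ?thesis by simp
qed

end
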